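(* Let $\mathcal{F}$ be a saturated fusion system over a finite $p$-group $S$. Then $\mathrm{rank}_{w}(\mathcal{F})=2$ if and only if both of the following hold: $\mathcal{F}^{e}\setminus\{O_p(\mathcal{F})\}\neq\emptyset$; and $N_{\mathcal{F}}(Q)^{\mathfrak{cr}}\setminus\{Q,N_S(Q)\}=\emptyset$ whenever $Q\in\mathcal{F}^{\mathfrak{cr}}\setminus\{S,O_p(\mathcal{F})\}$. Here $\mathcal{F}^e$ is the set of $\mathcal{F}$-essential subgroups, and for a fusion system $\mathcal{E}$, $\mathcal{E}^{\mathfrak{cr}}$ is the set of weakly centric-radical subgroups in $\mathcal{E}$.
   Context: A fusion system $\mathcal{F}$ over a finite $p$-group $S$ is a category whose objects are the subgroups of $S$, whose morphisms are injective group homomorphisms, which contains all homomorphisms induced by conjugation by elements of $S$, and in which every morphism is an $\mathcal{F}$-isomorphism followed by an inclusion; saturation is the usual notion. $Q\le S$ is $\mathcal{F}$-essential if it is fully $\mathcal{F}$-normalised ($|N_S(Q)|\ge|N_S(R)|$ for all $R$ $\mathcal{F}$-isomorphic to $Q$), $\mathcal{F}$-centric ($C_S(R)=Z(R)$ for all $R$ $\mathcal{F}$-isomorphic to $Q$), and $\mathrm{Out}_{\mathcal{F}}(Q)=\mathrm{Aut}_{\mathcal{F}}(Q)/\mathrm{Inn}(Q)$ has a strongly $p$-embedded subgroup. For a fusion system $\mathcal{E}$ over $T$ (not necessarily saturated) and $Q\le T$, $N_{\mathcal{E}}(Q)$ is the fusion system over $N_T(Q)$ whose morphisms $U\to V$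 are those $\varphi\in\mathrm{Hom}_{\mathcal{E}}(U,V)$ having an extension $\tilde\varphi\in\mathrm{Hom}_{\mathcal{E}}(UQ,VQ)$ with $\tilde\varphi(Q)=Q$. $Q$ is normal in $\mathcal{E}$ if $N_{\mathcal{E}}(Q)=\mathcal{E}$, and $O_p(\mathcal{E})$ is the largest subgroup of $T$ normal in $\mathcal{E}$. $Q$ is weakly centric-radical in $\mathcal{E}$ if $O_p(N_{\mathcal{E}}(Q))=Q$; so $\mathcal{E}^{\mathfrak{cr}}=\{Q\le T: O_p(N_{\mathcal{E}}(Q))=Q\}$. For a chain $\sigma\colon Q_0<Q_1<\cdots<Q_n$ of subgroups of $S$, let $\sigma_i\colon Q_0<\cdots<Q_i$, $N_{\mathcal{F}}(\sigma_0)=N_{\mathcal{F}}(Q_0)$ and $N_{\mathcal{F}}(\sigma_i)=N_{N_{\mathcal{F}}(\sigma_{i-1})}(Q_i)$. The chain is weakly centric-radical in $\mathcal{F}$ if $N_{\mathcal{F}}(Q_0)=\mathcal{F}$, $O_p(\mathcal{F})<Q_1$, and $Q_i$ is weakly centric-radical in $N_{\mathcal{F}}(\sigma_{i-1})$ for $1\le i\le n$. Its length is $n$. The weakly local rank $\mathrm{rank}_w(\mathcal{F})$ is the length of a longest weakly centric-radical chain in $\mathcal{F}$. Equivalently: $\mathrm{rank}_w(\mathcal{F})=0$ if $O_p(\mathcal{F})=S$, and otherwise $\mathrm{rank}_w(\mathcal{F})=1+\max\{\mathrm{rank}_w(N_{\mathcal{F}}(R)) : R\le S,\ O_p(N_{\mathcal{F}}(R))=R,\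 O_p(\mathcal{F})<R\}$. *)

theory Defs
  imports "HOL-Algebra.Bij" "HOL-Algebra.Sylow" "HOL-Algebra.Zassenhaus"
begin

section \<open>Finite group notions\<close>

definition centralizer :: "('a, 'b) monoid_scheme \<Rightarrow> 'a set \<Rightarrow> 'a set" where
  "centralizer G H = {g \<in> carrier G. \<forall>h\<in>H. g \<otimes>\<^bsub>G\<^esub> h = h \<otimes>\<^bsub>G\<^esub> g}"

definition center :: "('a, 'b) monoid_scheme \<Rightarrow> 'a set" where
  "center G = centralizer G (carrier G)"

definition sylow_subgroup :: "nat \<Rightarrow> ('a, 'b) monoid_scheme \<Rightarrow> 'a set \<Rightarrow> bool" where
  "sylow_subgroup p G H \<longleftrightarrow> subgroup H G \<and> card H = p ^ multiplicity p (order G)"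

definition strongly_embedded :: "nat \<Rightarrow> ('a, 'b) monoid_scheme \<Rightarrow> 'a set \<Rightarrow> bool" where
  "strongly_embedded p G H \<longleftrightarrow>
     subgroup H G \<and> H \<noteq> carrier G \<and> p dvd card H \<and>
     (\<forall>g \<in> carrier G - H. \<not> p dvd card (H \<inter> (g <#\<^bsub>G\<^esub> H #>\<^bsub>G\<^esub> inv\<^bsub>G\<^esub> g)))"

text \<open>Conjugation by \<open>g\<close> with domain \<open>P\<close>; like all maps below it is extensional on its domain.\<close>
definition conj_map :: "('a, 'b) monoid_scheme \<Rightarrow> 'a set \<Rightarrow> 'a \<Rightarrow> 'a \<Rightarrow> 'a" where
  "conj_map G P g = (\<lambda>x\<in>P. g \<otimes>\<^bsub>G\<^esub> x \<otimes>\<^bsub>G\<^esub> inv\<^bsub>G\<^esub> g)"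

section \<open>Fusion systems\<close>

text \<open>
  A fusion system \<open>F\<close> over \<open>S\<close> is the group \<open>S\<close> together with the morphism sets
  \<open>Hom F P Q\<close>; thus \<open>carrier F\<close> is (the underlying set of) \<open>S\<close>, and \<open>subgroup P F\<close>
  says that \<open>P \<le> S\<close>. Morphisms are extensional functions on their domain, and the morphism
  sets are empty unless both arguments are subgroups, so that equality of records is equality of
  fusion systems, including equality of the underlying groups.
\<close>
record 'a fusion = "'a monoid" +
  Hom :: "'a set \<Rightarrow> 'a set \<Rightarrow> ('a \<Rightarrow> 'a) set"

definition Iso :: "'a fusion \<Rightarrow> 'a set \<Rightarrow> 'a set \<Rightarrow> ('a \<Rightarrow> 'a) set" where
  "Iso F P Q = {\<phi> \<in> Hom F P Q. \<exists>\<psi> \<in> Hom F Q P.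
     compose P \<psi> \<phi> = (\<lambda>x\<in>P. x) \<and> compose Q \<phi> \<psi> = (\<lambda>x\<in>Q. x)}"

text \<open>Identities and inclusions are conjugations by \<open>\<one>\<close>, hence covered by \<open>Hom_conj\<close>.\<close>
locale fusion_system = group F for F :: "'a fusion" (structure) +
  fixes p :: nat
  assumes prime_p: "prime p"
    and finite_carrier: "finite (carrier F)"
    and p_group: "\<exists>n. order F = p ^ n"
    and Hom_subgroups: "\<phi> \<in> Hom F P Q \<Longrightarrow> subgroup P F \<and> subgroup Q F"
    and Hom_hom: "\<phi> \<in> Hom F P Q \<Longrightarrow> \<phi> \<in> hom (F\<lparr>carrier := P\<rparr>) (F\<lparr>carrier := Q\<rparr>)"
    and Hom_inj: "\<phi> \<in> Hom F P Q \<Longrightarrow> inj_on \<phi> P"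
    and Hom_extensional: "\<phi> \<in> Hom F P Q \<Longrightarrow> \<phi> \<in> extensional P"
    and Hom_compose: "\<lbrakk>\<phi> \<in> Hom F P Q; \<psi> \<in> Hom F Q R\<rbrakk> \<Longrightarrow> compose P \<psi> \<phi> \<in> Hom F P R"
    and Hom_conj: "\<lbrakk>subgroup P F; subgroup Q F; g \<in> carrier F; conj_map F P g ` P \<subseteq> Q\<rbrakk>
                   \<Longrightarrow> conj_map F P g \<in> Hom F P Q"
    and Hom_factor: "\<phi> \<in> Hom F P Q \<Longrightarrow> \<phi> \<in> Iso F P (\<phi> ` P)"

definition F_conjugate :: "'a fusion \<Rightarrow> 'a set \<Rightarrow> 'a set \<Rightarrow> bool" where
  "F_conjugate F P Q \<longleftrightarrow> Iso F P Q \<noteq> {}"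

definition Aut_F :: "'a fusion \<Rightarrow> 'a set \<Rightarrow> ('a \<Rightarrow> 'a) monoid" where
  "Aut_F F P = BijGroup P\<lparr>carrier := Iso F P P\<rparr>"

definition Aut_S :: "'a fusion \<Rightarrow> 'a set \<Rightarrow> ('a \<Rightarrow> 'a) set" where
  "Aut_S F P = conj_map F P ` normalizer F P"

definition Inn :: "'a fusion \<Rightarrow> 'a set \<Rightarrow> ('a \<Rightarrow> 'a) set" where
  "Inn F P = conj_map F P ` P"

definition Out_F :: "'a fusion \<Rightarrow> 'a set \<Rightarrow> ('a \<Rightarrow> 'a) set monoid" where
  "Out_F F P = Aut_F F P Mod Inn F P"

subsection \<open>Saturation\<close>

definition fully_automised :: "nat \<Rightarrow> 'a fusion \<Rightarrow> 'a set \<Rightarrow> bool" where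
  "fully_automised p F P \<longleftrightarrow> sylow_subgroup p (Aut_F F P) (Aut_S F P)"

text \<open>For \<open>\<phi> : Q \<rightarrow> P\<close> an isomorphism, the set of \<open>g \<in> N\<^sub>S(Q)\<close> with \<open>\<phi> c\<^sub>g \<phi>\<inverse> \<in> Aut\<^sub>S(P)\<close>.\<close>
definition extender :: "'a fusion \<Rightarrow> 'a set \<Rightarrow> 'a set \<Rightarrow> ('a \<Rightarrow> 'a) \<Rightarrow> 'a set" where
  "extender F Q P \<phi> = {g \<in> normalizer F Q.
     (\<lambda>y\<in>P. \<phi> (conj_map F Q g (inv_into Q \<phi> y))) \<in> Aut_S F P}"

definition receptive :: "'a fusion \<Rightarrow> 'a set \<Rightarrow> bool" where
  "receptive F P \<longleftrightarrow> (\<forall>Q. \<forall>\<phi> \<in> Iso F Q P.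
     \<exists>\<phi>' \<in> Hom F (extender F Q P \<phi>) (carrier F). restrict \<phi>' Q = \<phi>)"

locale saturated_fusion_system = fusion_system +
  assumes saturated: "subgroup P F \<Longrightarrow>
    \<exists>Q. F_conjugate F P Q \<and> fully_automised p F Q \<and> receptive F Q"

subsection \<open>Essential subgroups\<close>

definition fully_normalised :: "'a fusion \<Rightarrow> 'a set \<Rightarrow> bool" where
  "fully_normalised F Q \<longleftrightarrow>
     (\<forall>R. F_conjugate F Q R \<longrightarrow> card (normalizer F R) \<le> card (normalizer F Q))"

definition centric :: "'a fusion \<Rightarrow> 'a set \<Rightarrow> bool" where
  "centric F Q \<longleftrightarrow> (\<forall>R. F_conjugate F Q R \<longrightarrow> centralizer F R = center (F\<lparr>carrier := R\<rparr>))"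

definition essentials :: "nat \<Rightarrow> 'a fusion \<Rightarrow> 'a set set" where
  "essentials p F = {Q. subgroup Q F \<and> fully_normalised F Q \<and> centric F Q \<and>
     (\<exists>H. strongly_embedded p (Out_F F Q) H)}"

subsection \<open>Normalisers and weakly centric-radical subgroups\<close>

text \<open>The normaliser fusion system \<open>N\<^sub>E(Q)\<close> over \<open>N\<^sub>T(Q)\<close>, where \<open>T = carrier E\<close>.\<close>
definition normalizer_fs :: "'a fusion \<Rightarrow> 'a set \<Rightarrow> 'a fusion" where
  "normalizer_fs E Q = E\<lparr>carrier := normalizer E Q,
     Hom := (\<lambda>U V. {\<phi> \<in> Hom E U V. U \<subseteq> normalizer E Q \<and> V \<subseteq> normalizer E Q \<and>
       (\<exists>\<phi>' \<in> Hom E (U <#>\<^bsub>E\<^esub> Q) (V <#>\<^bsub>E\<^esub> Q). restrict \<phi>' U = \<phi> \<and> \<phi>' ` Q = Q)})\<rparr>"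

definition normal_fs :: "'a fusion \<Rightarrow> 'a set \<Rightarrow> bool" where
  "normal_fs E Q \<longleftrightarrow> subgroup Q E \<and> normalizer_fs E Q = E"

text \<open>Largest with respect to inclusion. It exists for every fusion system (saturated or not):
  the trivial subgroup is normal, and the product of two normal subgroups is normal.\<close>
definition O_p :: "'a fusion \<Rightarrow> 'a set" where
  "O_p E = (GREATEST Q. normal_fs E Q)"

definition centric_radicals :: "'a fusion \<Rightarrow> 'a set set" where
  "centric_radicals E = {Q. subgroup Q E \<and> O_p (normalizer_fs E Q) = Q}"

subsection \<open>The weakly local rank\<close>

text \<open>A chain \<open>Q\<^sub>0 < \<dots> < Q\<^sub>n\<close> is a sequence \<open>Q\<close> of which only the first \<open>n + 1\<close> terms matter;
  \<open>chain_normalizer F Q i\<close> is the iterated normaliser of its initial segment up to \<open>Q\<^sub>i\<close>.\<close>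
primrec chain_normalizer :: "'a fusion \<Rightarrow> (nat \<Rightarrow> 'a set) \<Rightarrow> nat \<Rightarrow> 'a fusion" where
  "chain_normalizer F Q 0 = normalizer_fs F (Q 0)"
| "chain_normalizer F Q (Suc i) = normalizer_fs (chain_normalizer F Q i) (Q (Suc i))"

definition centric_radical_chain :: "'a fusion \<Rightarrow> (nat \<Rightarrow> 'a set) \<Rightarrow> nat \<Rightarrow> bool" where
  "centric_radical_chain F Q n \<longleftrightarrow>
     (\<forall>i\<le>n. subgroup (Q i) F) \<and> (\<forall>i<n. Q i \<subset> Q (Suc i)) \<and>
     normalizer_fs F (Q 0) = F \<and> (1 \<le> n \<longrightarrow> O_p F \<subset> Q 1) \<and>
     (\<forall>i<n. Q (Suc i) \<in> centric_radicals (chain_normalizer F Q i))"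

text \<open>The set is nonempty (\<open>n = 0\<close>, \<open>Q\<^sub>0\<close> trivial) and finite (chains are strictly increasing).\<close>
definition rank_w :: "'a fusion \<Rightarrow> nat" where
  "rank_w F = Max {n. \<exists>Q. centric_radical_chain F Q n}"

end

theory Submission
  imports Defs "HOL-Algebra.Left_Coset"
begin

text \<open>
  Write \<open>S\<close> for \<open>carrier F\<close> and \<open>F\<^sup>c\<^sup>r\<close> for \<open>centric_radicals F\<close>. In every fusion system, saturated or
  not, members of \<open>F\<^sup>c\<^sup>r\<close> contain \<open>O\<^sub>p(F)\<close> (\<open>centric_radical_contains_O_p\<close>), and \<open>S\<close> itself belongs to
  \<open>F\<^sup>c\<^sup>r\<close>. Hence a chain of length two exists precisely if \<open>F\<^sup>c\<^sup>r\<close> has a member \<open>Q\<close> with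
  \<open>O\<^sub>p(F) < Q < S\<close>, the chain then being \<open>O\<^sub>p(F) < Q < N\<^sub>S(Q)\<close>. Applied once more to \<open>N\<^sub>F(Q)\<close>, the same
  argument shows that a chain of length three exists precisely if, for some such \<open>Q\<close>, the set
  \<open>N\<^sub>F(Q)\<^sup>c\<^sup>r\<close> has a member other than \<open>Q\<close> and \<open>N\<^sub>S(Q)\<close>. This is \<open>rank_w_eq_2_iff\<close>, and it leaves the
  claim that \<open>F\<^sup>c\<^sup>r\<close> has a member besides \<open>S\<close> and \<open>O\<^sub>p(F)\<close> if and only if there is an essential
  subgroup besides \<open>O\<^sub>p(F)\<close>.

  An essential subgroup \<open>E\<close> is a member of \<open>F\<^sup>c\<^sup>r\<close> different from \<open>S\<close>. A group with a strongly
  \<open>p\<close>-embedded subgroup has no nontrivial normal \<open>p\<close>-subgroup, so the normal \<open>p\<close>-subgroup of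
  \<open>Aut\<^sub>F(E)\<close> that \<open>O\<^sub>p(N\<^sub>F(E))\<close> induces is contained in \<open>Inn(E)\<close>; as \<open>E\<close> is centric,
  \<open>O\<^sub>p(N\<^sub>F(E)) = E\<close> (\<open>essential_centric_radical\<close>). For \<open>E = S\<close> the group \<open>Out\<^sub>F(S)\<close> has order prime to \<open>p\<close>
  (\<open>carrier_not_essential\<close>).

  Conversely, suppose that no subgroup strictly above \<open>O\<^sub>p(F)\<close> is essential. The argument of Alperin's
  fusion theorem shows that every morphism between such subgroups is the restriction of an
  automorphism of \<open>S\<close> in \<open>F\<close> (\<open>extends_to_carrier_of_no_essentials\<close>). For \<open>Q > O\<^sub>p(F)\<close> the morphisms of
  \<open>N\<^sub>F(Q)\<close> therefore extend to automorphisms of \<open>S\<close> that stabilise \<open>Q\<close>, hence \<open>N\<^sub>S(Q)\<close>. So \<open>N\<^sub>S(Q)\<close> is normal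
  in \<open>N\<^sub>F(Q)\<close>, and \<open>Q\<close> is weakly centric-radical only if \<open>Q = N\<^sub>S(Q)\<close>, that is, \<open>Q = S\<close>
  (\<open>centric_radical_eq_carrier_of_no_essentials\<close>).
\<close>

section \<open>Finite groups and their \<open>p\<close>-subgroups\<close>

definition p_subgroup :: "nat \<Rightarrow> ('a, 'b) monoid_scheme \<Rightarrow> 'a set \<Rightarrow> bool" where
  "p_subgroup p G P \<longleftrightarrow> subgroup P G \<and> (\<exists>n. card P = p ^ n)"

lemma p_subgroup_nontrivial_dvd:
  assumes "p_subgroup p G P" "x \<in> P" "y \<in> P" "x \<noteq> y"
  shows "p dvd card P"
proof -
  obtain n where n: "card P = p ^ n" using assms(1) by (auto simp: p_subgroup_def)
  have "n \<noteq> 0"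
  proof
    assume "n = 0"
    then have "card P = 1" using n by simp
    then show False using assms by (metis card_1_singletonE singletonD)
  qed
  then show ?thesis using n by (simp add: dvd_power)
qed

text \<open>
  By the orbit-stabiliser theorem every orbit has \<open>p\<close>-power length. If no orbit were a
  single point, \<open>p\<close> would divide the length of each orbit, and hence the size of the set.
\<close>
lemma (in group_action) p_group_fixed_point:
  assumes "prime p" "order G = p ^ n" "finite E" "\<not> p dvd card E"
  shows "\<exists>x\<in>E. \<forall>g\<in>carrier G. \<phi> g x = x"
proof (rule ccontr)
  assume nofix: "\<not> (\<exists>x\<in>E. \<forall>g\<in>carrier G. \<phi> g x = x)"
  have "p dvd card orb" if orb: "orb \<in> orbits G E \<phi>" for orb
  proof -
    obtain x where x: "x \<in> E" "orb = orbit G \<phi> x" using orb by (auto simp: orbits_def)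
    have "card orb dvd p ^ n" using orbit_stabilizer_theorem[OF x(1)] assms(2) x(2) by (metis dvd_triv_left)
    then obtain k where k: "card orb = p ^ k" using assms(1) by (meson divides_primepow_nat)
    have "k \<noteq> 0"
    proof
      assume "k = 0"
      then have "card orb = 1" using k by simp
      then have "orb = {x}" using orbit_refl[OF x(1)] x(2) by (metis card_1_singletonE singletonD)
      then have "\<forall>g\<in>carrier G. \<phi> g x = x" using x(2) unfolding orbit_def by auto
      with nofix x(1) show False by blast
    qed
    then show ?thesis using k by (simp add: dvd_power)
  qed
  then have "p dvd (\<Sum>orb\<in>orbits G E \<phi>. card orb)" by (simp add: dvd_sum)
  also have "(\<Sum>orb\<in>orbits G E \<phi>. card orb) = card E"
    using disjoint_sum[OF assms(3), of "\<lambda>_. 1::nat"] by simp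
  finally show False using assms(4) by simp
qed

context group
begin

text \<open>
  A left coset \<open>gT\<close> that is fixed by left multiplication with \<open>P\<close> is the same thing as an
  element \<open>g\<close> with \<open>g\<inverse>Pg \<le> T\<close>. Sylow conjugacy takes \<open>E\<close> to be all cosets; the growth of
  normalisers takes all cosets but \<open>T\<close> itself.
\<close>
lemma p_subgroup_fixes_left_coset:
  assumes "prime p" "p_subgroup p G P" "subgroup T G" "E \<subseteq> lcosets T" "finite E" "\<not> p dvd card E"
    and cl: "\<And>x C. \<lbrakk>x \<in> P; C \<in> E\<rbrakk> \<Longrightarrow> x <# C \<in> E"
  shows "\<exists>g\<in>carrier G. g <# T \<in> E \<and> (\<forall>x\<in>P. inv g \<otimes> x \<otimes> g \<in> T)"
proof -
  have P: "subgroup P G" using assms(2) by (simp add: p_subgroup_def)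
  obtain n where n: "card P = p ^ n" using assms(2) by (auto simp: p_subgroup_def)
  note Psub = subgroup.subset[OF P]
  have Ecar: "C \<subseteq> carrier G" if "C \<in> E" for C
    using that assms(4) lcosets_subset_PowG[OF assms(3)] by blast
  define \<phi> where "\<phi> = (\<lambda>x. \<lambda>C\<in>E. x <# C)"
  have inv_act: "inv x <# (x <# C) = C" "x <# (inv x <# C) = C" if "x \<in> P" "C \<in> E" for x C
    using that Psub Ecar[OF that(2)] by (auto simp: lcos_m_assoc lcos_mult_one subsetD)
  have bij: "\<phi> x \<in> Bij E" if x: "x \<in> P" for x
  proof -
    have ix: "inv x \<in> P" using P x by (simp add: subgroup.m_inv_closed)
    have "bij_betw (\<phi> x) E E"
      by (rule bij_betw_byWitness[where f' = "\<phi> (inv x)"])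
        (use x ix cl inv_act in \<open>auto simp: \<phi>_def\<close>)
    then show ?thesis by (simp add: Bij_def \<phi>_def)
  qed
  have "group_action (G\<lparr>carrier := P\<rparr>) E \<phi>"
  proof (rule group_action.intro, rule group_hom.intro)
    show "group (G\<lparr>carrier := P\<rparr>)" using P subgroup_imp_group by blast
    show "group (BijGroup E)" by (rule group_BijGroup)
    show "group_hom_axioms (G\<lparr>carrier := P\<rparr>) (BijGroup E) \<phi>"
    proof (rule group_hom_axioms.intro, rule homI)
      fix x assume "x \<in> carrier (G\<lparr>carrier := P\<rparr>)"
      then show "\<phi> x \<in> carrier (BijGroup E)" using bij by (simp add: BijGroup_def)
    next
      fix x y assume "x \<in> carrier (G\<lparr>carrier := P\<rparr>)" "y \<in> carrier (G\<lparr>carrier := P\<rparr>)"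
      then have x: "x \<in> P" and y: "y \<in> P" by auto
      have "compose E (\<phi> x) (\<phi> y) = \<phi> (x \<otimes> y)"
        using x y cl Psub Ecar by (auto simp: \<phi>_def compose_def lcos_m_assoc subsetD intro!: restrict_ext)
      then show "\<phi> (x \<otimes>\<^bsub>G\<lparr>carrier := P\<rparr>\<^esub> y) = \<phi> x \<otimes>\<^bsub>BijGroup E\<^esub> \<phi> y"
        using bij x y by (simp add: BijGroup_def)
    qed
  qed
  then obtain C where C: "C \<in> E" and fixC: "\<forall>x\<in>P. x <# C = C"
    using group_action.p_group_fixed_point[OF _ assms(1) _ assms(5,6), of "G\<lparr>carrier := P\<rparr>" \<phi> n] n
    by (auto simp: order_def \<phi>_def)
  then obtain g where g: "g \<in> carrier G" "C = g <# T" using assms(4) by (auto simp: LCOSETS_def)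
  have "inv g \<otimes> x \<otimes> g \<in> T" if x: "x \<in> P" for x
  proof -
    have xc: "x \<in> carrier G" using x Psub by blast
    have "g \<in> C" using lcos_self[OF g(1) assms(3)] g(2) by simp
    then have "x \<otimes> g \<in> x <# C" by (auto simp: l_coset_def)
    then have "x \<otimes> g \<in> g <# T" using fixC x g(2) by simp
    then have "inv g \<otimes> (x \<otimes> g) \<in> T"
      using subgroup.lcos_module_imp[OF assms(3) is_group g(1)] by blast
    then show ?thesis using g(1) xc by (simp add: m_assoc)
  qed
  with g C show ?thesis by blast
qed

text \<open>
  The index of a Sylow subgroup is prime to \<open>p\<close>, so \<open>P\<close> fixes one of its cosets.
\<close>
lemma p_subgroup_conj_into_sylow:
  assumes fin: "finite (carrier G)" and p: "prime p" and T: "sylow_subgroup p G T" and P: "p_subgroup p G P"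
  shows "\<exists>g\<in>carrier G. \<forall>x\<in>P. g \<otimes> x \<otimes> inv g \<in> T"
proof -
  have Ts: "subgroup T G" and Tc: "card T = p ^ multiplicity p (order G)"
    using T by (auto simp: sylow_subgroup_def)
  have lag: "card (lcosets T) * card T = order G" using l_lagrange[OF fin Ts] .
  have "order G \<noteq> 0" using fin order_gt_0_iff_finite by simp
  have nd: "\<not> p dvd card (lcosets T)"
  proof
    assume "p dvd card (lcosets T)"
    then have "p ^ Suc (multiplicity p (order G)) dvd order G"
      using lag Tc by (metis mult_dvd_mono dvd_refl power_Suc)
    then show False using p \<open>order G \<noteq> 0\<close>
      by (metis multiplicity_geI not_less_eq_eq not_prime_unit order_refl)
  qed
  have fl: "finite (lcosets T)"
    using fin lcosets_subset_PowG[OF Ts] by (meson finite_Pow_iff finite_subset)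
  have cl: "x <# C \<in> lcosets T" if x: "x \<in> P" and C: "C \<in> lcosets T" for x C
  proof -
    obtain g where g: "g \<in> carrier G" "C = g <# T" using C by (auto simp: LCOSETS_def)
    have xc: "x \<in> carrier G" using x P by (meson p_subgroup_def subgroup.mem_carrier)
    then have "x <# C = (x \<otimes> g) <# T" using g subgroup.subset[OF Ts] by (simp add: lcos_m_assoc)
    then show ?thesis using xc g by (auto simp: LCOSETS_def)
  qed
  obtain g where "g \<in> carrier G" "\<forall>x\<in>P. inv g \<otimes> x \<otimes> g \<in> T"
    using p_subgroup_fixes_left_coset[OF p P Ts subset_refl fl nd cl] by blast
  then show ?thesis by (intro bexI[of _ "inv g"]) auto
qed

text \<open>
  \<open>Q\<close> acts on the cosets \<open>gQ\<close> and fixes the coset \<open>Q\<close>. Their number is divisible by \<open>p\<close>, so the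
  number of the others is not, and \<open>Q\<close> fixes one of them as well.
\<close>
lemma p_group_normalizer_grows:
  assumes fin: "finite (carrier G)" and p: "prime p" and G: "order G = p ^ n" and Q: "subgroup Q G" "Q \<noteq> carrier G"
  shows "\<exists>g\<in>carrier G - Q. \<forall>x\<in>Q. g \<otimes> x \<otimes> inv g \<in> Q"
proof -
  note lag = l_lagrange[OF fin Q(1)]
  have "card Q dvd p ^ n" using lag G by (metis dvd_triv_right)
  then have Qp: "p_subgroup p G Q" using p Q(1) by (auto simp: p_subgroup_def divides_primepow_nat)
  have "card (lcosets Q) dvd p ^ n" using lag G by (metis dvd_triv_left)
  then obtain k where k: "card (lcosets Q) = p ^ k" using p by (auto simp: divides_primepow_nat)
  have "card Q < order G" unfolding order_def
    using Q subgroup.subset[OF Q(1)] fin by (simp add: psubset_card_mono psubsetI)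
  then have "k \<noteq> 0" using k lag by (intro notI) simp
  then have pd: "p dvd card (lcosets Q)" using k by (simp add: dvd_power)
  have fl: "finite (lcosets Q)"
    using fin lcosets_subset_PowG[OF Q(1)] by (meson finite_Pow_iff finite_subset)
  have Qin: "Q \<in> lcosets Q" unfolding LCOSETS_def
    using lcos_mult_one[OF subgroup.subset[OF Q(1)]] by (auto intro!: bexI[of _ \<one>])
  define E where "E = lcosets Q - {Q}"
  have "card (lcosets Q) = Suc (card E)" unfolding E_def using card.remove[OF fl Qin] .
  then have "p dvd card E + 1" using pd by simp
  then have nd: "\<not> p dvd card E" using p by (metis dvd_add_right_iff not_prime_unit)
  have cl: "x <# C \<in> E" if x: "x \<in> Q" and C: "C \<in> E" for x C
  proof -
    obtain g where g: "g \<in> carrier G" "C = g <# Q" using C by (auto simp: LCOSETS_def E_def)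
    have xc: "x \<in> carrier G" using x Q(1) by (meson subgroup.mem_carrier)
    have Cc: "C \<subseteq> carrier G" using g l_coset_subset_G subgroup.subset[OF Q(1)] by blast
    have "x <# C = (x \<otimes> g) <# Q" using g xc subgroup.subset[OF Q(1)] by (simp add: lcos_m_assoc)
    then have "x <# C \<in> lcosets Q" using xc g by (auto simp: LCOSETS_def)
    moreover have "x <# C \<noteq> Q"
    proof
      assume "x <# C = Q"
      then have "inv x <# Q = C" using xc Cc by (metis inv_closed l_inv lcos_m_assoc lcos_mult_one)
      moreover have "inv x <# Q = Q" using x xc Q(1) by (simp add: coset_join3 subgroup.m_inv_closed)
      ultimately show False using C by (simp add: E_def)
    qed
    ultimately show ?thesis by (simp add: E_def)
  qed
  have "E \<subseteq> lcosets Q" "finite E" using fl by (auto simp: E_def)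
  from p_subgroup_fixes_left_coset[OF p Qp Q(1) this nd] cl
  obtain g where g: "g \<in> carrier G" "g <# Q \<in> E" "\<forall>x\<in>Q. inv g \<otimes> x \<otimes> g \<in> Q" by blast
  have "inv g \<notin> Q"
  proof
    assume "inv g \<in> Q"
    then have "g \<in> Q" using g(1) Q(1) by (metis inv_inv subgroup.m_inv_closed)
    then show False using g Q(1) by (auto simp: E_def coset_join3)
  qed
  then show ?thesis using g by (intro bexI[of _ "inv g"]) auto
qed

lemma card_subgroup_dvd:
  assumes "subgroup P G" "subgroup Q G" "Q \<subseteq> P"
  shows "card Q dvd card P"
proof -
  interpret P: group "G\<lparr>carrier := P\<rparr>" using assms(1) by (rule subgroup_imp_group)
  show ?thesis
    using P.lagrange[OF subgroup_incl[OF assms(2,1,3)]] by (simp add: order_def) (metis dvd_triv_right)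
qed

lemma subgroup_of_p_subgroup:
  assumes "prime p" "p_subgroup p G P" "subgroup Q G" "Q \<subseteq> P"
  shows "p_subgroup p G Q"
proof -
  have "card Q dvd card P" using card_subgroup_dvd assms by (auto simp: p_subgroup_def)
  then show ?thesis using assms by (auto simp: p_subgroup_def divides_primepow_nat)
qed

lemma p_subgroup_normalizer_grows:
  assumes p: "prime p" and P: "p_subgroup p G P" and Q: "subgroup Q G" "Q \<subset> P"
  shows "\<exists>g\<in>P - Q. \<forall>x\<in>Q. g \<otimes> x \<otimes> inv g \<in> Q"
proof -
  have Ps: "subgroup P G" using P by (simp add: p_subgroup_def)
  obtain n where n: "card P = p ^ n" using P by (auto simp: p_subgroup_def)
  interpret P: group "G\<lparr>carrier := P\<rparr>" using Ps by (rule subgroup_imp_group)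
  have "finite P" using n p by (metis card_ge_0_finite prime_gt_0_nat zero_less_power)
  then have "\<exists>g\<in>P - Q. \<forall>x\<in>Q. g \<otimes> x \<otimes> inv\<^bsub>G\<lparr>carrier := P\<rparr>\<^esub> g \<in> Q"
    using P.p_group_normalizer_grows[OF _ p, of n Q] subgroup_incl[OF Q(1) Ps] Q n by (auto simp: order_def)
  then show ?thesis using Ps by auto
qed

end

lemma (in group_hom) card_image_subgroup:
  assumes "subgroup P G"
  shows "card (h ` P) dvd card P"
proof -
  interpret P: group_hom "G\<lparr>carrier := P\<rparr>" "H\<lparr>carrier := h ` P\<rparr>" h
  proof (rule group_hom.intro)
    show "group (G\<lparr>carrier := P\<rparr>)" using assms by (rule G.subgroup_imp_group)
    show "group (H\<lparr>carrier := h ` P\<rparr>)" using subgroup_img_is_subgroup[OF assms] by (rule H.subgroup_imp_group)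
    show "group_hom_axioms (G\<lparr>carrier := P\<rparr>) (H\<lparr>carrier := h ` P\<rparr>) h"
      using assms by (auto simp: group_hom_axioms_def hom_def subgroup.mem_carrier)
  qed
  let ?K = "kernel (G\<lparr>carrier := P\<rparr>) (H\<lparr>carrier := h ` P\<rparr>) h"
  have "card (rcosets\<^bsub>G\<lparr>carrier := P\<rparr>\<^esub> ?K) = card (h ` P)"
    using iso_same_order[OF P.FactGroup_iso_set] by (simp add: order_def FactGroup_def)
  then show ?thesis using P.G.lagrange[OF P.subgroup_kernel] by (metis dvd_triv_left order_def partial_object.select_convs(1) partial_object.surjective partial_object.update_convs(1))
qed

lemma (in group_hom) p_subgroup_image:
  assumes "prime p" "p_subgroup p G P"
  shows "p_subgroup p H (h ` P)"
  using assms card_image_subgroup[of P] subgroup_img_is_subgroup[of P]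
  by (auto simp: p_subgroup_def divides_primepow_nat)

lemma (in group) exists_subgroup_of_prime_card:
  assumes "finite (carrier G)" "prime p" "subgroup K G" "p dvd card K"
  shows "\<exists>P. subgroup P G \<and> P \<subseteq> K \<and> card P = p"
proof -
  interpret K: group "G\<lparr>carrier := K\<rparr>" using assms(3) by (rule subgroup_imp_group)
  obtain m where m: "card K = p * m" using assms(4) by blast
  have "finite K" using assms(1,3) subgroup.subset finite_subset by blast
  then obtain P where P: "subgroup P (G\<lparr>carrier := K\<rparr>)" "card P = p"
    using sylow_thm[OF assms(2) K.is_group, of 1 m] m by (auto simp: order_def)
  then show ?thesis using incl_subgroup[OF assms(3)] subgroup.subset[OF P(1)] by auto
qed

lemma (in group) normal_p_subgroup_mult:
  assumes "finite (carrier G)" "prime p" "R \<lhd> G" "p_subgroup p G R" "p_subgroup p G P"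
  shows "p_subgroup p G (R <#> P)"
proof -
  have P: "subgroup P G" and R: "subgroup R G" using assms by (auto simp: p_subgroup_def)
  have RP: "subgroup (R <#> P) G" using mult_norm_subgroup[OF assms(3) P] .
  interpret RP: group "G\<lparr>carrier := R <#> P\<rparr>" using RP by (rule subgroup_imp_group)
  interpret Pg: group "G\<lparr>carrier := P\<rparr>" using P by (rule subgroup_imp_group)
  have "R \<subseteq> R <#> P"
    using subgroup.one_closed[OF P] subgroup.subset[OF R] by (force simp: set_mult_def)
  then have 1: "card (rcosets\<^bsub>G\<lparr>carrier := R <#> P\<rparr>\<^esub> R) * card R = card (R <#> P)"
    using RP.lagrange[OF subgroup_incl[OF R RP]] by (simp add: order_def)
  have 2: "card (rcosets\<^bsub>G\<lparr>carrier := P\<rparr>\<^esub> (R \<inter> P)) * card (R \<inter> P) = card P"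
    using Pg.lagrange[OF subgroup_incl[OF subgroups_Inter_pair[OF R P] P]] by (simp add: order_def)
  have 3: "card (rcosets\<^bsub>G\<lparr>carrier := R <#> P\<rparr>\<^esub> R) = card (rcosets\<^bsub>G\<lparr>carrier := P\<rparr>\<^esub> (R \<inter> P))"
    using weak_snd_iso_thme[OF P assms(3)] iso_same_order
    by (fastforce simp: is_iso_def order_def FactGroup_def)
  obtain a b where ab: "card R = p ^ a" "card P = p ^ b" using assms by (auto simp: p_subgroup_def)
  have "card (R <#> P) dvd card P * card R" using 1 2 3 by (metis dvd_triv_left mult_dvd_mono dvd_refl)
  then have "card (R <#> P) dvd p ^ (b + a)" using ab by (simp add: power_add)
  then show ?thesis using RP assms(2) by (auto simp: p_subgroup_def divides_primepow_nat)
qed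

lemma (in group) mem_normalizer_iff:
  assumes "finite P" "P \<subseteq> carrier G"
  shows "g \<in> normalizer G P \<longleftrightarrow> g \<in> carrier G \<and> (\<forall>x\<in>P. g \<otimes> x \<otimes> inv g \<in> P)"
proof -
  have eq: "g <# P #> inv g = (\<lambda>x. g \<otimes> x \<otimes> inv g) ` P" by (auto simp: l_coset_def r_coset_def)
  have "(\<lambda>x. g \<otimes> x \<otimes> inv g) ` P = P \<longleftrightarrow> (\<lambda>x. g \<otimes> x \<otimes> inv g) ` P \<subseteq> P" if "g \<in> carrier G"
  proof -
    have "inj_on (\<lambda>x. g \<otimes> x \<otimes> inv g) P"
      using that assms(2) by (intro inj_onI) (simp add: subsetD)
    then show ?thesis using endo_inj_surj[OF assms(1)] by blast
  qed
  moreover have "g \<in> normalizer G P \<longleftrightarrow> g \<in> carrier G \<and> (\<lambda>x. g \<otimes> x \<otimes> inv g) ` P = P"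
    using assms(2) unfolding normalizer_def stabilizer_def eq[symmetric] by simp
  ultimately show ?thesis by blast
qed

section \<open>Strongly embedded subgroups\<close>

text \<open>
  An element \<open>g\<close> that conjugates a nontrivial \<open>p\<close>-subgroup of \<open>H\<close> into \<open>H\<close> lies in \<open>H\<close>
  (\<open>in_H\<close> in the proof). A maximal \<open>p\<close>-subgroup \<open>P\<close> of \<open>H\<close> is nontrivial, and so contains its
  normaliser in every larger \<open>p\<close>-subgroup, in particular in \<open>RP\<close>; this gives \<open>R \<le> P \<le> H\<close>. As
  \<open>R\<close> is normal, \<open>R \<noteq> 1\<close> would now put every element of the group into \<open>H\<close>.
\<close>
lemma (in group) strongly_embedded_imp_normal_p_subgroup_trivial:
  assumes fin: "finite (carrier G)" and p: "prime p" and H: "strongly_embedded p G H"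
    and R: "R \<lhd> G" "p_subgroup p G R"
  shows "R = {\<one>}"
proof -
  have Hs: "subgroup H G" and Hne: "H \<noteq> carrier G" and pH: "p dvd card H"
    and emb: "\<And>g. g \<in> carrier G \<Longrightarrow> g \<notin> H \<Longrightarrow> \<not> p dvd card (H \<inter> (g <# H #> inv g))"
    using H by (auto simp: strongly_embedded_def)
  have Rs: "subgroup R G" using R by (simp add: p_subgroup_def)
  have conjmem: "x \<in> g <# H #> inv g" if g: "g \<in> carrier G" and x: "x \<in> carrier G" "inv g \<otimes> x \<otimes> g \<in> H" for g x
  proof -
    have "x = g \<otimes> (inv g \<otimes> x \<otimes> g) \<otimes> inv g" using g x(1) by (metis inv_closed inv_inv m_assoc inv_solve_left inv_solve_right m_closed)
    then show ?thesis using x(2) by (force simp: l_coset_def r_coset_def)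
  qed
  have in_H: "g \<in> H" if g: "g \<in> carrier G" and Q: "p_subgroup p G Q" "Q \<noteq> {\<one>}" "Q \<subseteq> H"
    and cj: "\<And>x. x \<in> Q \<Longrightarrow> inv g \<otimes> x \<otimes> g \<in> H" for g Q
  proof (rule ccontr)
    assume gH: "g \<notin> H"
    have Qs: "subgroup Q G" using Q by (simp add: p_subgroup_def)
    have K: "subgroup (H \<inter> (g <# H #> inv g)) G"
      using subgroups_Inter_pair[OF Hs subgroup_conjugation_is_surj2[OF g Hs]] .
    have "Q \<subseteq> H \<inter> (g <# H #> inv g)"
      using Q(3) cj conjmem[OF g] subgroup.mem_carrier[OF Qs] by blast
    then have "card Q dvd card (H \<inter> (g <# H #> inv g))" using card_subgroup_dvd[OF K Qs] by blast
    moreover have "p dvd card Q"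
      using Q(2) p_subgroup_nontrivial_dvd[OF Q(1) subgroup.one_closed[OF Qs]] subgroup.one_closed[OF Qs] by blast
    ultimately show False using emb[OF g gH] dvd_trans by blast
  qed
  define PP where "PP = {P. p_subgroup p G P \<and> P \<subseteq> H}"
  have finPP: "finite PP"
    by (rule finite_subset[of _ "Pow (carrier G)"]) (use fin subgroup.subset[OF Hs] in \<open>auto simp: PP_def\<close>)
  obtain P1 where P1: "subgroup P1 G" "P1 \<subseteq> H" "card P1 = p"
    using exists_subgroup_of_prime_card[OF fin p Hs pH] by blast
  then have P1P: "P1 \<in> PP" by (auto simp: PP_def p_subgroup_def intro: exI[of _ 1])
  obtain P where P: "P \<in> PP" and Pmax: "\<And>P'. P' \<in> PP \<Longrightarrow> card P' \<le> card P"
    using obtains_MAX[of PP card] P1P finPP by (metis Max_ge empty_iff finite_imageI imageI)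
  have Pp: "p_subgroup p G P" and PH: "P \<subseteq> H" using P by (auto simp: PP_def)
  have Ps: "subgroup P G" using Pp by (simp add: p_subgroup_def)
  have Pn: "P \<noteq> {\<one>}" using Pmax[OF P1P] P1(3) p prime_gt_1_nat[OF p] by auto
  have RP: "p_subgroup p G (R <#> P)" by (rule normal_p_subgroup_mult[OF fin p R Pp])
  have RsubRP: "R \<subseteq> R <#> P" using subgroup.one_closed[OF Ps] subgroup.subset[OF Rs] by (force simp: set_mult_def)
  have PsubRP: "P \<subseteq> R <#> P" using subgroup.one_closed[OF Rs] subgroup.subset[OF Ps] by (force simp: set_mult_def)
  have "R <#> P = P"
  proof (rule ccontr)
    assume "R <#> P \<noteq> P"
    with PsubRP have "P \<subset> R <#> P" by simp
    from p_subgroup_normalizer_grows[OF p RP Ps this]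
    obtain g where g: "g \<in> (R <#> P) - P" "\<forall>x\<in>P. g \<otimes> x \<otimes> inv g \<in> P" by (elim bexE)
    \<comment> \<open>\<open>N\<close> is a \<open>p\<close>-subgroup of \<open>H\<close> by \<open>in_H\<close>, and \<open>g\<close> makes it larger than \<open>P\<close>.\<close>
    define N where "N = normalizer G P \<inter> (R <#> P)"
    have RPs: "subgroup (R <#> P) G" using RP by (simp add: p_subgroup_def)
    have finP: "finite P" using finite_subset[OF subgroup.subset[OF Ps] fin] .
    note nrm = mem_normalizer_iff[OF finP subgroup.subset[OF Ps]]
    have Ns: "subgroup N G" unfolding N_def
      using subgroups_Inter_pair[OF normalizer_imp_subgroup RPs] subgroup.subset[OF Ps] by blast
    have "p_subgroup p G N" by (rule subgroup_of_p_subgroup[OF p RP Ns]) (simp add: N_def)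
    moreover have "h \<in> H" if h: "h \<in> N" for h
    proof -
      have "inv h \<in> normalizer G P" using subgroup.m_inv_closed[OF Ns h] by (simp add: N_def)
      then have "inv h \<otimes> x \<otimes> h \<in> P" if "x \<in> P" for x
        using that nrm subgroup.mem_carrier[OF Ns h] by simp
      then show ?thesis using in_H[OF subgroup.mem_carrier[OF Ns h] Pp Pn PH] PH by blast
    qed
    ultimately have "N \<in> PP" by (auto simp: PP_def)
    moreover have "P \<subset> N"
    proof
      have "x \<in> normalizer G P" if "x \<in> P" for x
        using that nrm Ps by (simp add: subgroup.mem_carrier subgroup.m_closed subgroup.m_inv_closed)
      then show "P \<subseteq> N" using PsubRP by (auto simp: N_def)
      have "g \<in> N" using g nrm subgroup.mem_carrier[OF RPs] by (auto simp: N_def)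
      then show "P \<noteq> N" using g by blast
    qed
    then have "card P < card N" using Ns fin by (meson finite_subset psubset_card_mono subgroup.subset)
    ultimately show False using Pmax by (meson linorder_not_less)
  qed
  then have RH: "R \<subseteq> H" using RsubRP PH by blast
  show ?thesis
  proof (rule ccontr)
    assume Rn: "R \<noteq> {\<one>}"
    have "g \<in> H" if g: "g \<in> carrier G" for g
      using in_H[OF g R(2) Rn RH] RH normal.inv_op_closed1[OF R(1) g] by blast
    then show False using Hne subgroup.subset[OF Hs] by blast
  qed
qed

lemma (in normal) group_hom_Mod: "group_hom G (G Mod H) (\<lambda>x. H #> x)"
  using r_coset_hom_Mod factorgroup_is_group by (simp add: group_hom_def group_hom_axioms_def is_group)

text \<open>
  The image of \<open>R\<close> in the quotient is a normal \<open>p\<close>-subgroup, hence trivial. In this form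
  strong embedding in \<open>Out\<^sub>F(P) = Aut\<^sub>F(P)/Inn(P)\<close> becomes a statement about \<open>Aut\<^sub>F(P)\<close>.
\<close>
lemma (in group) strongly_embedded_Mod_imp_normal_p_subgroup_subset:
  assumes fin: "finite (carrier G)" and p: "prime p" and N: "N \<lhd> G"
    and H: "strongly_embedded p (G Mod N) H" and R: "R \<lhd> G" "p_subgroup p G R"
  shows "R \<subseteq> N"
proof -
  interpret N: normal N G by (rule N)
  interpret h: group_hom G "G Mod N" "\<lambda>x. N #> x" by (rule N.group_hom_Mod)
  have "finite (carrier (G Mod N))" using fin by (simp add: carrier_FactGroup)
  moreover have "(\<lambda>x. N #> x) ` R \<lhd> G Mod N"
    using normal.surj_hom_normal_subgroup[OF R(1) h.group_hom_axioms] by (simp add: carrier_FactGroup)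
  moreover have "p_subgroup p (G Mod N) ((\<lambda>x. N #> x) ` R)" using h.p_subgroup_image[OF p R(2)] .
  ultimately have "(\<lambda>x. N #> x) ` R = {N}"
    using h.H.strongly_embedded_imp_normal_p_subgroup_trivial[OF _ p H] by simp
  then have "N #> x = N" if "x \<in> R" for x using that by blast
  then show ?thesis
    using coset_join1[OF _ _ N.subgroup_axioms] R(2) by (meson p_subgroup_def subgroup.mem_carrier subsetI)
qed

text \<open>
  If \<open>p\<close> divides the order of the intersection of \<open>H/N\<close> with a conjugate, that intersection
  has a subgroup of order \<open>p\<close>. Its preimage \<open>Q\<close> is a \<open>p\<close>-subgroup strictly above \<open>N\<close>, so the
  embedding condition can be tested on such subgroups \<open>Q\<close> of the group itself.
\<close>
lemma (in group) strongly_embedded_ModI: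
  assumes fin: "finite (carrier G)" and p: "prime p" and N: "N \<lhd> G" "p_subgroup p G N"
    and H: "subgroup H G" "N \<subseteq> H" "H \<noteq> carrier G"
    and P: "p_subgroup p G P" "N \<subset> P" "P \<subseteq> H"
    and emb: "\<And>g Q. \<lbrakk>g \<in> carrier G; p_subgroup p G Q; N \<subset> Q; Q \<subseteq> H; \<And>x. x \<in> Q \<Longrightarrow> inv g \<otimes> x \<otimes> g \<in> H\<rbrakk> \<Longrightarrow> g \<in> H"
  shows "strongly_embedded p (G Mod N) ((\<lambda>x. N #> x) ` H)"
proof -
  interpret N: normal N G by (rule N)
  interpret h: group_hom G "G Mod N" "\<lambda>x. N #> x" by (rule N.group_hom_Mod)
  let ?M = "G Mod N" and ?H = "(\<lambda>x. N #> x) ` H"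
  note Ns = N.subgroup_axioms
  have finM: "finite (carrier ?M)" using fin by (simp add: carrier_FactGroup)
  have memH: "x \<in> H" if x: "x \<in> carrier G" and xH: "N #> x \<in> ?H" for x
  proof -
    obtain y where y: "y \<in> H" "N #> x = N #> y" using xH by blast
    have "x \<in> N #> y" using rcos_self[OF x Ns] y(2) by simp
    then show ?thesis using y(1) H(1,2) by (auto simp: r_coset_def subgroup.m_closed)
  qed
  have Hs: "subgroup ?H ?M" using h.subgroup_img_is_subgroup[OF H(1)] .
  moreover have "?H \<noteq> carrier ?M"
  proof
    assume "?H = carrier ?M"
    then have "carrier G \<subseteq> H" using memH by (auto simp: carrier_FactGroup)
    then show False using H subgroup.subset[OF H(1)] by blast
  qed
  moreover have "p dvd card ?H"
  proof -
    obtain x where x: "x \<in> P" "x \<notin> N" using P(2) by blast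
    have Pim: "p_subgroup p ?M ((\<lambda>x. N #> x) ` P)" using h.p_subgroup_image[OF p P(1)] .
    have xc: "x \<in> carrier G" using x P(1) by (meson p_subgroup_def subgroup.mem_carrier)
    have "N #> x \<noteq> N #> \<one>" using coset_join1[OF _ xc Ns] x(2) coset_mult_one[OF N.subset] by auto
    moreover have "\<one> \<in> P" using P(1) by (simp add: p_subgroup_def subgroup.one_closed)
    ultimately have "p dvd card ((\<lambda>x. N #> x) ` P)"
      using p_subgroup_nontrivial_dvd[OF Pim imageI[OF x(1)] imageI[of \<one>]] by blast
    moreover have "card ((\<lambda>x. N #> x) ` P) dvd card ?H"
      using h.H.card_subgroup_dvd[OF Hs] Pim P(3) by (simp add: p_subgroup_def image_mono)
    ultimately show ?thesis by (rule dvd_trans)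
  qed
  moreover have "\<not> p dvd card (?H \<inter> (C <#\<^bsub>?M\<^esub> ?H #>\<^bsub>?M\<^esub> inv\<^bsub>?M\<^esub> C))" if C: "C \<in> carrier ?M - ?H" for C
  proof
    assume dv: "p dvd card (?H \<inter> (C <#\<^bsub>?M\<^esub> ?H #>\<^bsub>?M\<^esub> inv\<^bsub>?M\<^esub> C))"
    obtain g where g: "g \<in> carrier G" "C = N #> g" using C by (auto simp: carrier_FactGroup)
    have gH: "g \<notin> H" using C g by blast
    have Cc: "C \<in> carrier ?M" using C by blast
    have K: "subgroup (?H \<inter> (C <#\<^bsub>?M\<^esub> ?H #>\<^bsub>?M\<^esub> inv\<^bsub>?M\<^esub> C)) ?M"
      by (rule h.H.subgroups_Inter_pair[OF Hs h.H.subgroup_conjugation_is_surj2[OF Cc Hs]])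
    obtain A where A: "subgroup A ?M" "A \<subseteq> ?H \<inter> (C <#\<^bsub>?M\<^esub> ?H #>\<^bsub>?M\<^esub> inv\<^bsub>?M\<^esub> C)" "card A = p"
      using h.H.exists_subgroup_of_prime_card[OF finM p K dv] by blast
    define Q where "Q = \<Union>A"
    have Qeq: "Q = {x \<in> carrier G. N #> x \<in> A}" unfolding Q_def by (rule N.factgroup_subgroup_union_char[OF A(1)])
    have Qs: "subgroup Q G" unfolding Q_def by (rule N.factgroup_subgroup_union_subgroup[OF A(1)])
    have NA: "N \<in> A" using subgroup.one_closed[OF A(1)] by simp
    have NQ: "N \<subseteq> Q" using NA by (auto simp: Q_def)
    have "N \<noteq> Q"
    proof
      assume NQ: "N = Q"
      have "X = N" if X: "X \<in> A" for X
      proof -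
        obtain x where x: "x \<in> carrier G" "X = N #> x"
          using subgroup.mem_carrier[OF A(1) X] by (auto simp: carrier_FactGroup)
        then have "x \<in> N" using X NQ Qeq by blast
        then show ?thesis using x coset_join2[OF x(1) Ns] by simp
      qed
      then have "A = {N}" using NA by blast
      then show False using A(3) p prime_gt_1_nat by fastforce
    qed
    moreover have "p_subgroup p G Q"
    proof -
      interpret Q: group "G\<lparr>carrier := Q\<rparr>" using Qs by (rule subgroup_imp_group)
      have "A = rcosets\<^bsub>G\<lparr>carrier := Q\<rparr>\<^esub> N" unfolding Q_def by (rule N.factgroup_subgroup_union_factor[OF A(1)])
      then have "card A * card N = card Q"
        using Q.lagrange[OF subgroup_incl[OF Ns Qs NQ]] by (simp add: order_def)
      moreover obtain n where "card N = p ^ n" using N(2) by (auto simp: p_subgroup_def)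
      ultimately have "card Q = p ^ Suc n" using A(3) by simp
      then show ?thesis using Qs unfolding p_subgroup_def by blast
    qed
    moreover have "Q \<subseteq> H" using Qeq A(2) memH by blast
    moreover have "inv g \<otimes> x \<otimes> g \<in> H" if x: "x \<in> Q" for x
    proof -
      have xc: "x \<in> carrier G" and xA: "N #> x \<in> A" using x Qeq by auto
      obtain y where y: "y \<in> H" "N #> x = C \<otimes>\<^bsub>?M\<^esub> (N #> y) \<otimes>\<^bsub>?M\<^esub> inv\<^bsub>?M\<^esub> C"
        using xA A(2) by (auto simp: l_coset_def r_coset_def)
      have yc: "y \<in> carrier G" using y(1) H(1) by (simp add: subgroup.mem_carrier)
      have ig: "inv\<^bsub>?M\<^esub> C = N #> inv g" using h.hom_inv[OF g(1)] g(2) by simp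
      have nx: "N #> (inv g \<otimes> x \<otimes> g) = inv\<^bsub>?M\<^esub> C \<otimes>\<^bsub>?M\<^esub> (N #> x) \<otimes>\<^bsub>?M\<^esub> C"
        using g xc ig h.hom_mult by simp
      have nyc: "N #> y \<in> carrier ?M" using yc h.hom_closed by simp
      have "inv\<^bsub>?M\<^esub> C \<otimes>\<^bsub>?M\<^esub> (N #> x) \<otimes>\<^bsub>?M\<^esub> C = N #> y"
        unfolding y(2) using Cc nyc
        by (metis (no_types, opaque_lifting) h.H.inv_closed h.H.inv_solve_left h.H.inv_solve_right h.H.m_assoc h.H.m_closed)
      then have "N #> (inv g \<otimes> x \<otimes> g) \<in> ?H" using nx y(1) by auto
      then show ?thesis using memH g(1) xc by simp
    qed
    ultimately show False using emb[OF g(1), of Q] NQ gH by blast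
  qed
  ultimately show ?thesis unfolding strongly_embedded_def by blast
qed

section \<open>Morphisms and automorphism groups in a fusion system\<close>

context fusion_system
begin

lemma Hom_maps: "\<lbrakk>\<phi> \<in> Hom F P Q; x \<in> P\<rbrakk> \<Longrightarrow> \<phi> x \<in> Q"
  using Hom_hom by (fastforce simp: hom_def)

lemma Hom_image: "\<phi> \<in> Hom F P Q \<Longrightarrow> \<phi> ` P \<subseteq> Q"
  using Hom_maps by blast

lemma Hom_mult: "\<lbrakk>\<phi> \<in> Hom F P Q; x \<in> P; y \<in> P\<rbrakk> \<Longrightarrow> \<phi> (x \<otimes> y) = \<phi> x \<otimes> \<phi> y"
  using Hom_hom by (fastforce simp: hom_def)

lemma Hom_group_hom: "\<phi> \<in> Hom F P Q \<Longrightarrow> group_hom (F\<lparr>carrier := P\<rparr>) (F\<lparr>carrier := Q\<rparr>) \<phi>"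
  using Hom_hom Hom_subgroups by (simp add: group_hom_def group_hom_axioms_def subgroup_imp_group)

lemma Hom_one: "\<phi> \<in> Hom F P Q \<Longrightarrow> \<phi> \<one> = \<one>"
  using group_hom.hom_one[OF Hom_group_hom] by fastforce

lemma Hom_inv: "\<phi> \<in> Hom F P Q \<Longrightarrow> x \<in> P \<Longrightarrow> \<phi> (inv x) = inv \<phi> x"
  using group_hom.hom_inv[OF Hom_group_hom, of \<phi> P Q x] Hom_subgroups[of \<phi> P Q] Hom_maps[of \<phi> P Q x] by simp

lemma finite_subgroup: "subgroup P F \<Longrightarrow> finite P"
  using finite_carrier finite_subset subgroup.subset by blast

lemma subgroup_p_subgroup: "subgroup P F \<Longrightarrow> p_subgroup p F P"
  using subgroup_of_p_subgroup[OF prime_p _ _ subgroup.subset] p_group subgroup_self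
  by (auto simp: p_subgroup_def order_def)

lemma IsoD:
  assumes "\<phi> \<in> Iso F P Q"
  shows "\<phi> \<in> Hom F P Q" "\<phi> ` P = Q" "restrict (inv_into P \<phi>) Q \<in> Iso F Q P"
proof -
  obtain \<psi> where h: "\<phi> \<in> Hom F P Q" and \<psi>: "\<psi> \<in> Hom F Q P" "compose P \<psi> \<phi> = (\<lambda>x\<in>P. x)" "compose Q \<phi> \<psi> = (\<lambda>x\<in>Q. x)"
    using assms by (auto simp: Iso_def)
  show "\<phi> \<in> Hom F P Q" by (rule h)
  have 1: "\<phi> (\<psi> y) = y" if "y \<in> Q" for y using \<psi>(3) that by (metis compose_eq restrict_apply')
  show im: "\<phi> ` P = Q" using 1 Hom_maps[OF h] Hom_maps[OF \<psi>(1)] by (force simp: image_iff)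
  have "restrict (inv_into P \<phi>) Q = \<psi>"
  proof (rule extensionalityI[of _ Q])
    show "\<psi> \<in> extensional Q" by (rule Hom_extensional[OF \<psi>(1)])
    show "restrict (inv_into P \<phi>) Q y = \<psi> y" if "y \<in> Q" for y
      using that 1[OF that] Hom_maps[OF \<psi>(1) that] Hom_inj[OF h] by (simp add: inv_into_f_eq)
  qed simp
  then show "restrict (inv_into P \<phi>) Q \<in> Iso F Q P" using h \<psi> by (auto simp: Iso_def)
qed

text \<open>
  Every morphism is an isomorphism onto its image, so surjectivity is all that is to check.
\<close>
lemma Iso_altdef: "\<phi> \<in> Iso F P Q \<longleftrightarrow> \<phi> \<in> Hom F P Q \<and> \<phi> ` P = Q"
  using IsoD Hom_factor by blast

lemma Hom_inclusion: "\<lbrakk>subgroup P F; subgroup Q F; P \<subseteq> Q\<rbrakk> \<Longrightarrow> (\<lambda>x\<in>P. x) \<in> Hom F P Q"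
proof -
  assume a: "subgroup P F" "subgroup Q F" "P \<subseteq> Q"
  have "conj_map F P \<one> = (\<lambda>x\<in>P. x)" using subgroup.mem_carrier[OF a(1)] by (auto simp: conj_map_def)
  then show ?thesis using Hom_conj[of P Q \<one>] a by auto
qed

lemma Hom_change_codomain:
  assumes "\<phi> \<in> Hom F P Q" "\<phi> ` P \<subseteq> R" "subgroup R F"
  shows "\<phi> \<in> Hom F P R"
proof -
  have 1: "\<phi> \<in> Hom F P (\<phi> ` P)" using Hom_factor[OF assms(1)] IsoD by blast
  have "compose P (\<lambda>x\<in>\<phi> ` P. x) \<phi> \<in> Hom F P R"
    using Hom_compose[OF 1 Hom_inclusion] Hom_subgroups[OF 1] assms by blast
  moreover have "compose P (\<lambda>x\<in>\<phi> ` P. x) \<phi> = \<phi>"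
    using Hom_extensional[OF assms(1)] by (intro extensionalityI[of _ P]) (auto simp: compose_def)
  ultimately show ?thesis by simp
qed

lemma Hom_restrict:
  assumes "\<phi> \<in> Hom F P Q" "U \<subseteq> P" "subgroup U F"
  shows "restrict \<phi> U \<in> Hom F U Q"
proof -
  have "compose U \<phi> (\<lambda>x\<in>U. x) \<in> Hom F U Q"
    using Hom_compose[OF Hom_inclusion assms(1)] Hom_subgroups[OF assms(1)] assms by blast
  moreover have "compose U \<phi> (\<lambda>x\<in>U. x) = restrict \<phi> U" by (auto simp: compose_def)
  ultimately show ?thesis by simp
qed

lemma subgroup_image:
  assumes "\<phi> \<in> Hom F P Q" "U \<subseteq> P" "subgroup U F"
  shows "subgroup (\<phi> ` U) F"
proof -
  have "restrict \<phi> U \<in> Hom F U (restrict \<phi> U ` U)"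
    using Hom_factor[OF Hom_restrict[OF assms]] by (rule IsoD)
  then have "subgroup (restrict \<phi> U ` U) F" using Hom_subgroups by blast
  then show ?thesis by simp
qed

lemma Iso_compose: "\<lbrakk>\<phi> \<in> Iso F P Q; \<psi> \<in> Iso F Q R\<rbrakk> \<Longrightarrow> compose P \<psi> \<phi> \<in> Iso F P R"
  using Hom_compose[of \<phi> P Q \<psi> R] surj_compose[of \<phi> P Q \<psi> R] by (simp add: Iso_altdef)

lemma Iso_id: "subgroup P F \<Longrightarrow> (\<lambda>x\<in>P. x) \<in> Iso F P P"
  by (simp add: Iso_altdef Hom_inclusion)

lemma Iso_Bij: "Iso F P P \<subseteq> Bij P"
proof
  fix \<phi> assume "\<phi> \<in> Iso F P P"
  then have "\<phi> \<in> Hom F P P" "\<phi> ` P = P" by (simp_all add: Iso_altdef)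
  then show "\<phi> \<in> Bij P"
    using Hom_extensional[of \<phi> P P] Hom_inj[of \<phi> P P] by (simp add: Bij_def bij_betw_def)
qed

lemma Iso_card: "\<phi> \<in> Iso F P Q \<Longrightarrow> card P = card Q"
  using card_image[OF Hom_inj] by (auto simp: Iso_altdef)

lemma subgroup_Iso: "subgroup P F \<Longrightarrow> subgroup (Iso F P P) (BijGroup P)"
proof (rule group.subgroupI[OF group_BijGroup])
  assume P: "subgroup P F"
  show "Iso F P P \<subseteq> carrier (BijGroup P)" using Iso_Bij by (simp add: BijGroup_def)
  show "Iso F P P \<noteq> {}" using Iso_id[OF P] by blast
  show "inv\<^bsub>BijGroup P\<^esub> \<phi> \<in> Iso F P P" if "\<phi> \<in> Iso F P P" for \<phi>
    using that IsoD(3)[OF that] Iso_Bij by (subst inv_BijGroup) auto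
  show "\<phi> \<otimes>\<^bsub>BijGroup P\<^esub> \<psi> \<in> Iso F P P" if "\<phi> \<in> Iso F P P" "\<psi> \<in> Iso F P P" for \<phi> \<psi>
    using Iso_compose[OF that(2,1)] subsetD[OF Iso_Bij that(1)] subsetD[OF Iso_Bij that(2)]
    by (simp add: BijGroup_def)
qed

lemma group_Aut_F: "subgroup P F \<Longrightarrow> group (Aut_F F P)"
  unfolding Aut_F_def using group.subgroup_imp_group[OF group_BijGroup subgroup_Iso] .

lemma carrier_Aut_F: "carrier (Aut_F F P) = Iso F P P"
  by (simp add: Aut_F_def)

lemma mult_Aut_F: "\<lbrakk>\<phi> \<in> Iso F P P; \<psi> \<in> Iso F P P\<rbrakk> \<Longrightarrow> \<phi> \<otimes>\<^bsub>Aut_F F P\<^esub> \<psi> = compose P \<phi> \<psi>"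
  using subsetD[OF Iso_Bij[of P], of \<phi>] subsetD[OF Iso_Bij[of P], of \<psi>] by (simp add: Aut_F_def BijGroup_def)

lemma one_Aut_F: "\<one>\<^bsub>Aut_F F P\<^esub> = (\<lambda>x\<in>P. x)"
  by (simp add: Aut_F_def BijGroup_def)

lemma inv_Aut_F: "subgroup P F \<Longrightarrow> \<phi> \<in> Iso F P P \<Longrightarrow> inv\<^bsub>Aut_F F P\<^esub> \<phi> = restrict (inv_into P \<phi>) P"
  using group.m_inv_consistent[OF group_BijGroup subgroup_Iso, of P \<phi>] inv_BijGroup[of \<phi> P] subsetD[OF Iso_Bij, of \<phi> P]
  unfolding Aut_F_def by simp

lemma finite_Aut_F: "subgroup P F \<Longrightarrow> finite (carrier (Aut_F F P))"
proof -
  assume P: "subgroup P F"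
  have "Iso F P P \<subseteq> PiE P (\<lambda>_. P)"
  proof
    fix \<phi> assume "\<phi> \<in> Iso F P P"
    then have "\<phi> \<in> Hom F P P" by (simp add: Iso_altdef)
    then show "\<phi> \<in> PiE P (\<lambda>_. P)"
      using Hom_maps[of \<phi> P P] Hom_extensional[of \<phi> P P] by (simp add: PiE_def)
  qed
  then show ?thesis unfolding carrier_Aut_F
    by (rule finite_subset) (use finite_subgroup[OF P] in \<open>simp add: finite_PiE\<close>)
qed

lemma mem_normalizer: "subgroup P F \<Longrightarrow> g \<in> normalizer F P \<longleftrightarrow> g \<in> carrier F \<and> (\<forall>x\<in>P. g \<otimes> x \<otimes> inv g \<in> P)"
  using mem_normalizer_iff[OF finite_subgroup[of P] subgroup.subset[of P F]] by simp

lemma subgroup_normalizer: "subgroup P F \<Longrightarrow> subgroup (normalizer F P) F"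
  using normalizer_imp_subgroup[OF subgroup.subset[of P F]] .

lemma subset_normalizer: "subgroup P F \<Longrightarrow> P \<subseteq> normalizer F P"
  by (rule subsetI) (simp add: mem_normalizer subgroup.mem_carrier subgroup.m_closed subgroup.m_inv_closed)

lemma normalizer_grows_within:
  assumes "subgroup P F" "subgroup Q F" "Q \<subset> P"
  shows "\<exists>g \<in> normalizer F Q \<inter> P. g \<notin> Q"
proof -
  from p_subgroup_normalizer_grows[OF prime_p subgroup_p_subgroup[OF assms(1)] assms(2,3)]
  obtain g where g: "g \<in> P - Q" "\<forall>x\<in>Q. g \<otimes> x \<otimes> inv g \<in> Q" by (elim bexE)
  then have "g \<in> normalizer F Q"
    using subgroup.mem_carrier[OF assms(1)] by (simp add: mem_normalizer[OF assms(2)])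
  with g show ?thesis by blast
qed

lemma subset_mult:
  assumes "subgroup U F" "subgroup Q F"
  shows "U \<subseteq> U <#> Q" "Q \<subseteq> U <#> Q"
proof -
  have "u \<otimes> \<one> \<in> U <#> Q" if "u \<in> U" for u
    using that subgroup.one_closed[OF assms(2)] by (auto simp: set_mult_def)
  then show "U \<subseteq> U <#> Q" using subgroup.mem_carrier[OF assms(1)] by auto
  have "\<one> \<otimes> u \<in> U <#> Q" if "u \<in> Q" for u
    using that subgroup.one_closed[OF assms(1)] by (auto simp: set_mult_def)
  then show "Q \<subseteq> U <#> Q" using subgroup.mem_carrier[OF assms(2)] by auto
qed

lemma mult_subset: "subgroup W F \<Longrightarrow> U \<subseteq> W \<Longrightarrow> Q \<subseteq> W \<Longrightarrow> U <#> Q \<subseteq> W"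
  using subgroup.m_closed[of W F] by (auto simp: set_mult_def)

lemma subgroup_mult:
  assumes U: "subgroup U F" and Q: "subgroup Q F" and UN: "U \<subseteq> normalizer F Q"
  shows "subgroup (U <#> Q) F"
proof -
  have N: "subgroup (normalizer F Q) F" using subgroup_normalizer[OF Q] .
  have "subgroup (Q <#> U) (F\<lparr>carrier := normalizer F Q\<rparr>)"
    using mult_norm_sub_in_sub[OF subgroup_in_normalizer[OF Q] subgroup_incl[OF U N UN] N] .
  moreover have "Q <#> U = U <#> Q"
    using group.commut_normal[OF subgroup_imp_group[OF N] subgroup_incl[OF U N UN] subgroup_in_normalizer[OF Q]] by simp
  ultimately show ?thesis using incl_subgroup[OF N] by simp
qed

lemma Hom_image_mult:
  assumes "\<phi> \<in> Hom F W V" "U \<subseteq> W" "Q \<subseteq> W"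
  shows "\<phi> ` (U <#> Q) = \<phi> ` U <#> \<phi> ` Q"
proof -
  have "\<phi> (u \<otimes> q) = \<phi> u \<otimes> \<phi> q" if "u \<in> U" "q \<in> Q" for u q
    using that assms Hom_mult[OF assms(1)] by blast
  then show ?thesis unfolding set_mult_def image_UN image_insert image_empty by simp
qed

end

section \<open>Normaliser fusion systems\<close>

lemma subgroup_Hom_update [simp]: "subgroup U (E\<lparr>Hom := h\<rparr>) \<longleftrightarrow> subgroup U E"
  by (simp add: subgroup_def m_inv_def)

lemma group_Hom_update [simp]: "group (E\<lparr>Hom := h\<rparr>) \<longleftrightarrow> group E"
  unfolding group_def monoid_def group_axioms_def Units_def by simp

lemma m_inv_Hom_update [simp]: "m_inv (E\<lparr>Hom := h\<rparr>) x = m_inv E x"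
  by (simp add: m_inv_def)

lemma carrier_normalizer_fs [simp]: "carrier (normalizer_fs E Q) = normalizer E Q"
  by (simp add: normalizer_fs_def)

lemma mult_normalizer_fs [simp]: "monoid.mult (normalizer_fs E Q) = monoid.mult E"
  by (simp add: normalizer_fs_def)

lemma set_mult_normalizer_fs [simp]: "set_mult (normalizer_fs E Q) = set_mult E"
  by (simp add: set_mult_def fun_eq_iff)

context fusion_system
begin

lemma inv_normalizer_fs:
  assumes "subgroup Q F" "x \<in> normalizer F Q"
  shows "m_inv (normalizer_fs F Q) x = inv x"
  using m_inv_consistent[OF subgroup_normalizer[OF assms(1)] assms(2)] by (simp add: normalizer_fs_def)

lemma subgroup_normalizer_fs:
  assumes "subgroup Q F"
  shows "subgroup U (normalizer_fs F Q) \<longleftrightarrow> subgroup U F \<and> U \<subseteq> normalizer F Q"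
proof -
  note N = subgroup_normalizer[OF assms]
  have "subgroup U (normalizer_fs F Q) \<longleftrightarrow> subgroup U (F\<lparr>carrier := normalizer F Q\<rparr>)"
    by (simp add: normalizer_fs_def)
  also have "\<dots> \<longleftrightarrow> subgroup U F \<and> U \<subseteq> normalizer F Q"
    using incl_subgroup[OF N, of U] subgroup_incl[OF _ N, of U] subgroup.subset[of U "F\<lparr>carrier := normalizer F Q\<rparr>"]
    by auto
  finally show ?thesis .
qed

lemma Hom_normalizer_fsD:
  assumes "\<phi> \<in> Hom (normalizer_fs F Q) U V"
  shows "\<phi> \<in> Hom F U V" "U \<subseteq> normalizer F Q" "V \<subseteq> normalizer F Q"
    "\<exists>\<psi> \<in> Hom F (U <#> Q) (V <#> Q). (\<forall>x\<in>U. \<psi> x = \<phi> x) \<and> \<psi> ` Q = Q"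
  using assms by (auto simp: normalizer_fs_def)

text \<open>
  The overgroup \<open>W\<close> may be any subgroup above \<open>U\<close> and \<open>Q\<close>: it contains \<open>UQ\<close>, and the
  restriction of \<open>\<psi>\<close> to \<open>UQ\<close> has image \<open>\<psi>(U)Q\<close>.
\<close>
lemma restrict_in_Hom_normalizer_fs:
  assumes \<psi>: "\<psi> \<in> Hom F W X" and U: "subgroup U F" "U \<subseteq> W" "U \<subseteq> normalizer F Q"
    and Q: "subgroup Q F" "Q \<subseteq> W" "\<psi> ` Q = Q"
    and V: "subgroup V F" "\<psi> ` U \<subseteq> V" "V \<subseteq> normalizer F Q"
  shows "restrict \<psi> U \<in> Hom (normalizer_fs F Q) U V"
proof -
  have Ws: "subgroup W F" using Hom_subgroups[OF \<psi>] by simp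
  have UQ: "subgroup (U <#> Q) F" using subgroup_mult[OF U(1) Q(1) U(3)] .
  have VQ: "subgroup (V <#> Q) F" using subgroup_mult[OF V(1) Q(1) V(3)] .
  have UQW: "U <#> Q \<subseteq> W" by (rule mult_subset[OF Ws U(2) Q(2)])
  have 1: "restrict \<psi> U \<in> Hom F U V"
    by (rule Hom_change_codomain[OF Hom_restrict[OF \<psi> U(2,1)] _ V(1)]) (use V(2) in simp)
  have "\<psi> ` (U <#> Q) = \<psi> ` U <#> Q" using Hom_image_mult[OF \<psi> U(2) Q(2)] Q(3) by simp
  then have im: "restrict \<psi> (U <#> Q) ` (U <#> Q) \<subseteq> V <#> Q" using mono_set_mult[OF V(2) subset_refl, of F Q] by simp
  have 2: "restrict \<psi> (U <#> Q) \<in> Hom F (U <#> Q) (V <#> Q)"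
    by (rule Hom_change_codomain[OF Hom_restrict[OF \<psi> UQW UQ] im VQ])
  have "restrict \<psi> (U <#> Q) ` Q = \<psi> ` Q"
    using subset_mult(2)[OF U(1) Q(1)] by (intro image_cong refl) auto
  then have 3: "restrict (restrict \<psi> (U <#> Q)) U = restrict \<psi> U" "restrict \<psi> (U <#> Q) ` Q = Q"
    using subset_mult(1)[OF U(1) Q(1)] Q(3) by (auto simp: Int_absorb1 restrict_restrict)
  have "\<exists>\<phi>'\<in>Hom F (U <#> Q) (V <#> Q). restrict \<phi>' U = restrict \<psi> U \<and> \<phi>' ` Q = Q"
    using 2 3 by blast
  then show ?thesis using 1 U(3) V(3) by (simp add: normalizer_fs_def)
qed

lemma Hom_normalizer_fsI:
  assumes \<phi>: "\<phi> \<in> Hom F U V" and \<psi>: "\<psi> \<in> Hom F W X" and ext: "\<And>x. x \<in> U \<Longrightarrow> \<psi> x = \<phi> x"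
    and U: "U \<subseteq> W" "U \<subseteq> normalizer F Q" and V: "V \<subseteq> normalizer F Q"
    and Q: "subgroup Q F" "Q \<subseteq> W" "\<psi> ` Q = Q"
  shows "\<phi> \<in> Hom (normalizer_fs F Q) U V"
proof -
  have UV: "subgroup U F" "subgroup V F" using Hom_subgroups[OF \<phi>] by auto
  have "\<phi> = restrict \<psi> U"
    using ext Hom_extensional[OF \<phi>] by (intro extensionalityI[of _ U]) auto
  moreover have "\<psi> ` U \<subseteq> V" using ext Hom_maps[OF \<phi>] by auto
  ultimately show ?thesis
    using restrict_in_Hom_normalizer_fs[OF \<psi> UV(1) U Q UV(2) _ V] by simp
qed

text \<open>
  The extensions to \<open>UQ\<close> that stabilise \<open>Q\<close> are closed under composition and inversion, and
  an element of \<open>N\<^sub>S(Q)\<close> acts on all of \<open>N\<^sub>S(Q)\<close> and stabilises \<open>Q\<close>.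
\<close>
lemma fusion_system_normalizer_fs:
  assumes Q: "subgroup Q F"
  shows "fusion_system (normalizer_fs F Q) p"
proof -
  let ?N = "normalizer_fs F Q"
  note N = subgroup_normalizer[OF Q]
  note sub = subgroup_normalizer_fs[OF Q]
  have conj_eq: "conj_map ?N P g = conj_map F P g" if "g \<in> normalizer F Q" for P g
    using inv_normalizer_fs[OF Q that] by (simp add: conj_map_def)
  have ex: "\<exists>\<psi> \<in> Hom F (U <#> Q) (\<phi> ` U <#> Q). (\<forall>x\<in>U. \<psi> x = \<phi> x) \<and> \<psi> ` Q = Q \<and> \<psi> ` (U <#> Q) = \<phi> ` U <#> Q"
    if \<phi>: "\<phi> \<in> Hom ?N U V" for \<phi> U V
  proof -
    note d = Hom_normalizer_fsD[OF \<phi>]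
    from d(4) obtain \<psi> where \<psi>: "\<psi> \<in> Hom F (U <#> Q) (V <#> Q)" "\<forall>x\<in>U. \<psi> x = \<phi> x" "\<psi> ` Q = Q" by blast
    have U: "subgroup U F" using Hom_subgroups[OF d(1)] by simp
    have im: "\<psi> ` (U <#> Q) = \<phi> ` U <#> Q"
      using Hom_image_mult[OF \<psi>(1) subset_mult[OF U Q]] \<psi>(2,3) by simp
    have "\<phi> ` U \<subseteq> normalizer F Q" using Hom_image[OF d(1)] d(3) by simp
    then have im': "subgroup (\<phi> ` U <#> Q) F" by (rule subgroup_mult[OF subgroup_image[OF d(1) subset_refl U] Q])
    have "\<psi> \<in> Hom F (U <#> Q) (\<phi> ` U <#> Q)" by (rule Hom_change_codomain[OF \<psi>(1) _ im']) (simp add: im)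
    then show ?thesis using \<psi>(2,3) im by (intro bexI[of _ \<psi>]) auto
  qed
  have img: "\<phi> \<in> Hom ?N U (\<phi> ` U)" "restrict (inv_into U \<phi>) (\<phi> ` U) \<in> Hom ?N (\<phi> ` U) U"
    if \<phi>: "\<phi> \<in> Hom ?N U V" for \<phi> U V
  proof -
    note d = Hom_normalizer_fsD[OF \<phi>]
    have U: "subgroup U F" using Hom_subgroups[OF d(1)] by simp
    from ex[OF \<phi>] obtain \<psi> where \<psi>: "\<psi> \<in> Hom F (U <#> Q) (\<phi> ` U <#> Q)" "\<forall>x\<in>U. \<psi> x = \<phi> x" "\<psi> ` Q = Q"
      "\<psi> ` (U <#> Q) = \<phi> ` U <#> Q" by blast
    have iso: "\<phi> \<in> Iso F U (\<phi> ` U)" using Hom_factor[OF d(1)] .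
    have imN: "\<phi> ` U \<subseteq> normalizer F Q" using Hom_image[OF d(1)] d(3) by simp
    show "\<phi> \<in> Hom ?N U (\<phi> ` U)"
      by (rule Hom_normalizer_fsI[OF IsoD(1)[OF iso] \<psi>(1)]) (use \<psi> d(2) imN subset_mult[OF U Q] Q in simp_all)
    have isop: "\<psi> \<in> Iso F (U <#> Q) (\<phi> ` U <#> Q)" using \<psi>(1,4) by (simp add: Iso_altdef)
    define \<psi>' where "\<psi>' = restrict (inv_into (U <#> Q) \<psi>) (\<phi> ` U <#> Q)"
    have \<psi>': "\<psi>' \<in> Hom F (\<phi> ` U <#> Q) (U <#> Q)" unfolding \<psi>'_def by (rule IsoD(1)[OF IsoD(3)[OF isop]])
    have pinv: "\<psi>' (\<psi> x) = x" if "x \<in> U <#> Q" for x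
      using Hom_inj[OF \<psi>(1)] Hom_maps[OF \<psi>(1)] that by (simp add: \<psi>'_def)
    have im: "subgroup (\<phi> ` U) F" using subgroup_image[OF d(1) subset_refl U] .
    show "restrict (inv_into U \<phi>) (\<phi> ` U) \<in> Hom ?N (\<phi> ` U) U"
    proof (rule Hom_normalizer_fsI[OF IsoD(1)[OF IsoD(3)[OF iso]] \<psi>'])
      fix y assume "y \<in> \<phi> ` U"
      then obtain x where x: "x \<in> U" "y = \<phi> x" by blast
      then have "\<psi>' y = x" using pinv[OF subsetD[OF subset_mult(1)[OF U Q] x(1)]] \<psi>(2) by simp
      then show "\<psi>' y = restrict (inv_into U \<phi>) (\<phi> ` U) y" using x Hom_inj[OF d(1)] by simp
    next
      have "(\<lambda>x. \<psi>' (\<psi> x)) ` Q = (\<lambda>x. x) ` Q"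
        using pinv subset_mult(2)[OF U Q] by (intro image_cong refl) (simp add: subsetD)
      then show "\<psi>' ` Q = Q" using \<psi>(3) by (metis image_ident image_image)
    qed (use subset_mult[OF im Q] imN d(2) Q in simp_all)
  qed
  show ?thesis
  proof (rule fusion_system.intro[OF _ fusion_system_axioms.intro])
    show "group ?N" using subgroup_imp_group[OF N] by (simp add: normalizer_fs_def)
    show "prime p" by (rule prime_p)
    show "finite (carrier ?N)" using finite_subgroup[OF N] by simp
    show "\<exists>n. order ?N = p ^ n" using subgroup_p_subgroup[OF N] by (simp add: p_subgroup_def order_def)
  next
    fix \<phi> U V assume \<phi>: "\<phi> \<in> Hom ?N U V"
    note d = Hom_normalizer_fsD[OF \<phi>]
    show "subgroup U ?N \<and> subgroup V ?N" using Hom_subgroups[OF d(1)] d(2,3) sub by simp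
    show "\<phi> \<in> hom (?N\<lparr>carrier := U\<rparr>) (?N\<lparr>carrier := V\<rparr>)"
      using Hom_hom[OF d(1)] by (simp add: hom_def)
    show "inj_on \<phi> U" using Hom_inj[OF d(1)] .
    show "\<phi> \<in> extensional U" using Hom_extensional[OF d(1)] .
    note i = img[OF \<phi>]
    have "compose U (restrict (inv_into U \<phi>) (\<phi> ` U)) \<phi> = (\<lambda>x\<in>U. x)"
      using Hom_inj[OF d(1)] by (auto simp: compose_def)
    moreover have "compose (\<phi> ` U) \<phi> (restrict (inv_into U \<phi>) (\<phi> ` U)) = (\<lambda>x\<in>\<phi> ` U. x)"
      using Hom_inj[OF d(1)] by (auto simp: compose_def f_inv_into_f)
    ultimately show "\<phi> \<in> Iso ?N U (\<phi> ` U)" using i unfolding Iso_def by blast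
  next
    fix \<phi> \<psi> U V W assume \<phi>: "\<phi> \<in> Hom ?N U V" and \<psi>: "\<psi> \<in> Hom ?N V W"
    note d = Hom_normalizer_fsD[OF \<phi>] and e = Hom_normalizer_fsD[OF \<psi>]
    have U: "subgroup U F" using Hom_subgroups[OF d(1)] by simp
    from d(4) obtain \<phi>' where p: "\<phi>' \<in> Hom F (U <#> Q) (V <#> Q)" "\<forall>x\<in>U. \<phi>' x = \<phi> x" "\<phi>' ` Q = Q" by blast
    from e(4) obtain \<psi>' where q: "\<psi>' \<in> Hom F (V <#> Q) (W <#> Q)" "\<forall>x\<in>V. \<psi>' x = \<psi> x" "\<psi>' ` Q = Q" by blast
    note s = subset_mult[OF U Q]
    show "compose U \<psi> \<phi> \<in> Hom ?N U W"
    proof (rule Hom_normalizer_fsI[OF Hom_compose[OF d(1) e(1)] Hom_compose[OF p(1) q(1)] _ s(1) d(2) e(3) Q s(2)])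
      fix x assume x: "x \<in> U"
      then show "compose (U <#> Q) \<psi>' \<phi>' x = compose U \<psi> \<phi> x"
        using p(2) q(2) Hom_maps[OF d(1) x] s(1) by (simp add: compose_def subsetD)
    next
      have "compose (U <#> Q) \<psi>' \<phi>' ` Q = \<psi>' ` \<phi>' ` Q" using s(2) by (force simp: compose_def image_image)
      then show "compose (U <#> Q) \<psi>' \<phi>' ` Q = Q" using p(3) q(3) by simp
    qed
  next
    fix U V g assume a: "subgroup U ?N" "subgroup V ?N" "g \<in> carrier ?N" "conj_map ?N U g ` U \<subseteq> V"
    have gN: "g \<in> normalizer F Q" and gc: "g \<in> carrier F" using a(3) mem_normalizer[OF Q] by auto
    have U: "subgroup U F" "U \<subseteq> normalizer F Q" and V: "subgroup V F" "V \<subseteq> normalizer F Q" using a sub by auto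
    have "conj_map F U g \<in> Hom F U V" using Hom_conj[OF U(1) V(1) gc] a(4) conj_eq[OF gN] by simp
    moreover have "conj_map F (normalizer F Q) g \<in> Hom F (normalizer F Q) (normalizer F Q)"
    proof (rule Hom_conj[OF N N gc])
      show "conj_map F (normalizer F Q) g ` normalizer F Q \<subseteq> normalizer F Q"
        using gN N by (auto simp: conj_map_def subgroup.m_closed subgroup.m_inv_closed)
    qed
    moreover have "conj_map F (normalizer F Q) g ` Q = Q"
    proof (rule endo_inj_surj[OF finite_subgroup[OF Q]])
      show "conj_map F (normalizer F Q) g ` Q \<subseteq> Q"
        using gN mem_normalizer[OF Q] subset_normalizer[OF Q] by (auto simp: conj_map_def subset_iff)
      show "inj_on (conj_map F (normalizer F Q) g) Q"
        using Hom_inj[OF calculation(2)] subset_normalizer[OF Q] inj_on_subset by blast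
    qed
    ultimately have "conj_map F U g \<in> Hom ?N U V"
      using U V Q subset_normalizer[OF Q]
      by (intro Hom_normalizer_fsI[where \<psi> = "conj_map F (normalizer F Q) g"]) (auto simp: conj_map_def subset_iff)
    then show "conj_map ?N U g \<in> Hom ?N U V" using conj_eq[OF gN] by simp
  qed
qed

end

section \<open>Normal subgroups and \<open>O\<^sub>p\<close>\<close>

context fusion_system
begin

lemma Hom_carrier: "\<phi> \<in> Hom F P Q \<Longrightarrow> \<phi> \<in> Hom F P (carrier F)"
  using Hom_change_codomain[of \<phi> P Q "carrier F"] Hom_image[of \<phi> P Q] Hom_subgroups[of \<phi> P Q]
    subgroup.subset[of Q F] subgroup_self by blast

lemma conj_map_Iso:
  assumes "subgroup P F" "g \<in> normalizer F P"
  shows "conj_map F P g \<in> Iso F P P"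
proof -
  have g: "g \<in> carrier F" and im: "conj_map F P g ` P \<subseteq> P"
    using assms(2) by (auto simp: mem_normalizer[OF assms(1)] conj_map_def)
  have h: "conj_map F P g \<in> Hom F P P" by (rule Hom_conj[OF assms(1) assms(1) g im])
  then show ?thesis
    using endo_inj_surj[OF finite_subgroup[OF assms(1)] im Hom_inj[OF h]] by (simp add: Iso_altdef)
qed

lemma Hom_normalizer:
  assumes \<psi>: "\<psi> \<in> Hom F W V" and Q: "subgroup Q F" "Q \<subseteq> W" and w: "w \<in> W" "w \<in> normalizer F Q"
  shows "\<psi> w \<in> normalizer F (\<psi> ` Q)"
proof -
  have W: "subgroup W F" "subgroup V F" using Hom_subgroups[OF \<psi>] by auto
  have "\<psi> w \<otimes> \<psi> x \<otimes> inv \<psi> w \<in> \<psi> ` Q" if x: "x \<in> Q" for x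
  proof -
    have xW: "x \<in> W" using x Q(2) by blast
    have "\<psi> (w \<otimes> x \<otimes> inv w) = \<psi> w \<otimes> \<psi> x \<otimes> inv \<psi> w"
      using Hom_mult[OF \<psi>] Hom_inv[OF \<psi>] w(1) xW W(1)
      by (simp add: subgroup.m_closed subgroup.m_inv_closed)
    moreover have "w \<otimes> x \<otimes> inv w \<in> Q" using w(2) x by (simp add: mem_normalizer[OF Q(1)])
    ultimately show ?thesis by (metis imageI)
  qed
  moreover have "\<psi> w \<in> carrier F" using Hom_maps[OF \<psi> w(1)] subgroup.mem_carrier[OF W(2)] by blast
  ultimately show ?thesis by (simp add: mem_normalizer[OF subgroup_image[OF \<psi> Q(2,1)]])
qed

lemma normal_fsD:
  assumes "normal_fs F Q"
  shows "subgroup Q F" "normalizer_fs F Q = F" "normalizer F Q = carrier F"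
proof -
  show 1: "subgroup Q F" "normalizer_fs F Q = F" using assms by (auto simp: normal_fs_def)
  show "normalizer F Q = carrier F" using arg_cong[OF 1(2), of carrier] by simp
qed

lemma normal_fs_extend:
  assumes Q: "normal_fs F Q" and \<phi>: "\<phi> \<in> Hom F U V"
  obtains \<psi> where "\<psi> \<in> Hom F (U <#> Q) (V <#> Q)" "\<forall>x\<in>U. \<psi> x = \<phi> x" "\<psi> ` Q = Q"
    "subgroup (U <#> Q) F" "U \<subseteq> U <#> Q" "Q \<subseteq> U <#> Q"
proof -
  have "\<phi> \<in> Hom (normalizer_fs F Q) U V" using \<phi> normal_fsD(2)[OF Q] by simp
  from Hom_normalizer_fsD(4)[OF this]
  obtain \<psi> where \<psi>: "\<psi> \<in> Hom F (U <#> Q) (V <#> Q)" "\<forall>x\<in>U. \<psi> x = \<phi> x" "\<psi> ` Q = Q" by blast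
  have U: "subgroup U F" using Hom_subgroups[OF \<phi>] by simp
  note s = subset_mult[OF U normal_fsD(1)[OF Q]]
  show ?thesis using that[OF \<psi> _ s] Hom_subgroups[OF \<psi>(1)] by simp
qed

lemma normal_fs_image:
  assumes Q: "normal_fs F Q" and \<phi>: "\<phi> \<in> Hom F U V" "Q \<subseteq> U"
  shows "\<phi> ` Q = Q"
proof -
  from normal_fs_extend[OF Q \<phi>(1)] obtain \<psi> where \<psi>: "\<forall>x\<in>U. \<psi> x = \<phi> x" "\<psi> ` Q = Q" .
  have "\<phi> ` Q = \<psi> ` Q" using \<psi>(1) \<phi>(2) by (intro image_cong refl) (simp add: subsetD)
  then show ?thesis using \<psi>(2) by simp
qed

text \<open>
  The extension property makes \<open>Q\<close> a normal subgroup of \<open>S\<close>: the extension of conjugation by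
  \<open>g\<close> on \<open>Q\<close> agrees with it on \<open>Q\<close> and stabilises \<open>Q\<close>. So \<open>N\<^sub>S(Q) = S\<close>, and the extra
  condition on the morphisms of \<open>N\<^sub>F(Q)\<close> holds for all morphisms of \<open>F\<close>.
\<close>
lemma normal_fsI:
  assumes Q: "subgroup Q F"
    and ext: "\<And>U V \<phi>. \<phi> \<in> Hom F U V \<Longrightarrow>
       \<exists>W X \<psi>. \<psi> \<in> Hom F W X \<and> U \<subseteq> W \<and> Q \<subseteq> W \<and> (\<forall>x\<in>U. \<psi> x = \<phi> x) \<and> \<psi> ` Q = Q"
  shows "normal_fs F Q"
proof -
  have "g \<in> normalizer F Q" if g: "g \<in> carrier F" for g
  proof -
    have "conj_map F Q g \<in> Hom F Q (carrier F)"
      using Hom_conj[OF Q subgroup_self g] g subgroup.mem_carrier[OF Q] by (auto simp: conj_map_def)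
    from ext[OF this] obtain \<psi> where "\<forall>x\<in>Q. \<psi> x = conj_map F Q g x" "\<psi> ` Q = Q" by blast
    then have "conj_map F Q g x \<in> Q" if "x \<in> Q" for x using that by (metis imageI)
    then show ?thesis using g by (simp add: mem_normalizer[OF Q] conj_map_def)
  qed
  then have N: "normalizer F Q = carrier F" using mem_normalizer[OF Q] by blast
  have "Hom (normalizer_fs F Q) U V = Hom F U V" for U V
  proof
    show "Hom (normalizer_fs F Q) U V \<subseteq> Hom F U V" by (auto simp: normalizer_fs_def)
    show "Hom F U V \<subseteq> Hom (normalizer_fs F Q) U V"
    proof
      fix \<phi> assume \<phi>: "\<phi> \<in> Hom F U V"
      from ext[OF \<phi>] obtain W X \<psi> where \<psi>: "\<psi> \<in> Hom F W X" "U \<subseteq> W" "Q \<subseteq> W" "\<forall>x\<in>U. \<psi> x = \<phi> x" "\<psi> ` Q = Q" by blast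
      have UV: "U \<subseteq> carrier F" "V \<subseteq> carrier F" using Hom_subgroups[OF \<phi>] subgroup.subset by blast+
      show "\<phi> \<in> Hom (normalizer_fs F Q) U V"
        by (rule Hom_normalizer_fsI[OF \<phi> \<psi>(1)]) (use \<psi> UV N Q in simp_all)
    qed
  qed
  then have H: "Hom (normalizer_fs F Q) = Hom F" by (intro HOL.ext)
  have "normalizer_fs F Q = F"
    by (rule fusion.equality) (use N H in \<open>simp_all add: normalizer_fs_def\<close>)
  then show ?thesis using Q by (simp add: normal_fs_def)
qed

lemma normal_fs_trivial: "normal_fs F {\<one>}"
proof (rule normal_fsI)
  show "subgroup {\<one>} F" by (rule triv_subgroup)
  fix U V \<phi> assume \<phi>: "\<phi> \<in> Hom F U V"
  have "\<one> \<in> U" using Hom_subgroups[OF \<phi>] subgroup.one_closed by blast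
  moreover have "\<phi> ` {\<one>} = {\<one>}" using Hom_one[OF \<phi>] by simp
  ultimately show "\<exists>W X \<psi>. \<psi> \<in> Hom F W X \<and> U \<subseteq> W \<and> {\<one>} \<subseteq> W \<and> (\<forall>x\<in>U. \<psi> x = \<phi> x) \<and> \<psi> ` {\<one>} = {\<one>}"
    using \<phi> by blast
qed

text \<open>
  A morphism on \<open>U\<close> is extended first to \<open>UP\<close> and then to \<open>UPQ\<close>; the second extension
  still stabilises \<open>P\<close>, because it agrees with the first one there.
\<close>
lemma normal_fs_mult:
  assumes P: "normal_fs F P" and Q: "normal_fs F Q"
  shows "normal_fs F (P <#> Q)"
proof (rule normal_fsI)
  note Ps = normal_fsD(1)[OF P] and Qs = normal_fsD(1)[OF Q]
  show PQ: "subgroup (P <#> Q) F"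
    by (rule subgroup_mult[OF Ps Qs]) (simp add: normal_fsD(3)[OF Q] subgroup.subset[OF Ps])
  fix U V \<phi> assume \<phi>: "\<phi> \<in> Hom F U V"
  obtain \<psi> where \<psi>: "\<psi> \<in> Hom F (U <#> P) (V <#> P)" "\<forall>x\<in>U. \<psi> x = \<phi> x" "\<psi> ` P = P"
    "subgroup (U <#> P) F" "U \<subseteq> U <#> P" "P \<subseteq> U <#> P" using normal_fs_extend[OF P \<phi>] .
  let ?W = "U <#> P <#> Q" and ?X = "V <#> P <#> Q"
  obtain \<theta> where \<theta>: "\<theta> \<in> Hom F ?W ?X" "\<forall>x\<in>U <#> P. \<theta> x = \<psi> x" "\<theta> ` Q = Q"
    "subgroup ?W F" "U <#> P \<subseteq> ?W" "Q \<subseteq> ?W" using normal_fs_extend[OF Q \<psi>(1)] .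
  have PW: "P \<subseteq> ?W" using \<psi>(6) \<theta>(5) by (rule subset_trans)
  have "\<theta> ` P = \<psi> ` P" using \<theta>(2) \<psi>(6) by (intro image_cong refl) (simp add: subsetD)
  then have "\<theta> ` (P <#> Q) = P <#> Q" using Hom_image_mult[OF \<theta>(1) PW \<theta>(6)] \<psi>(3) \<theta>(3) by simp
  moreover have "P <#> Q \<subseteq> ?W" by (rule mult_subset[OF \<theta>(4) PW \<theta>(6)])
  moreover have "U \<subseteq> ?W" using \<psi>(5) \<theta>(5) by (rule subset_trans)
  moreover have "\<forall>x\<in>U. \<theta> x = \<phi> x" using \<theta>(2) \<psi>(2,5) by (simp add: subsetD)
  ultimately show "\<exists>W X \<psi>. \<psi> \<in> Hom F W X \<and> U \<subseteq> W \<and> P <#> Q \<subseteq> W \<and> (\<forall>x\<in>U. \<psi> x = \<phi> x) \<and> \<psi> ` (P <#> Q) = P <#> Q"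
    using \<theta>(1) by blast
qed

text \<open>
  A normal subgroup \<open>P\<close> of maximal order contains every other normal subgroup \<open>Q\<close>, since
  \<open>PQ\<close> is normal too. So the inclusion-greatest normal subgroup of the definition exists.
\<close>
lemma normal_fs_O_p: "normal_fs F (O_p F)" and normal_fs_subset_O_p: "normal_fs F Q \<Longrightarrow> Q \<subseteq> O_p F"
proof -
  let ?A = "{Q. normal_fs F Q}"
  have fin: "finite ?A"
    by (rule finite_subset[of _ "Pow (carrier F)"])
      (use finite_carrier normal_fsD(1) subgroup.subset in \<open>blast, simp\<close>)
  obtain P where P: "normal_fs F P" "\<And>Q. normal_fs F Q \<Longrightarrow> card Q \<le> card P"
    using obtains_MAX[of ?A card] fin normal_fs_trivial by (metis Max_ge empty_iff finite_imageI imageI mem_Collect_eq)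
  have max: "Q \<subseteq> P" if Q: "normal_fs F Q" for Q
  proof -
    note s = subset_mult[OF normal_fsD(1)[OF P(1)] normal_fsD(1)[OF Q]]
    have PQ: "normal_fs F (P <#> Q)" by (rule normal_fs_mult[OF P(1) Q])
    have "P = P <#> Q"
      by (rule card_seteq[OF finite_subgroup[OF normal_fsD(1)[OF PQ]] s(1) P(2)[OF PQ]])
    then show ?thesis using s(2) by simp
  qed
  have "O_p F = P" unfolding O_p_def by (rule Greatest_equality[where P = "normal_fs F", OF P(1) max])
  then show "normal_fs F (O_p F)" "normal_fs F Q \<Longrightarrow> Q \<subseteq> O_p F" using P(1) max by auto
qed

lemma normal_fs_normalizer_fs:
  assumes Q: "subgroup Q F"
  shows "normal_fs (normalizer_fs F Q) Q"
proof -
  let ?N = "normalizer_fs F Q"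
  interpret N: fusion_system ?N p by (rule fusion_system_normalizer_fs[OF Q])
  note QN = subset_normalizer[OF Q]
  show ?thesis
  proof (rule N.normal_fsI)
    show "subgroup Q ?N" using Q QN by (simp add: subgroup_normalizer_fs[OF Q])
    fix U V \<phi> assume \<phi>: "\<phi> \<in> Hom ?N U V"
    note d = Hom_normalizer_fsD[OF \<phi>]
    from d(4) obtain \<psi> where \<psi>: "\<psi> \<in> Hom F (U <#> Q) (V <#> Q)" "\<forall>x\<in>U. \<psi> x = \<phi> x" "\<psi> ` Q = Q" by blast
    have U: "subgroup U F" using Hom_subgroups[OF d(1)] by simp
    note s = subset_mult[OF U Q]
    note NN = subgroup_normalizer[OF Q]
    have "\<psi> \<in> Hom ?N (U <#> Q) (V <#> Q)"
      by (rule Hom_normalizer_fsI[OF \<psi>(1) \<psi>(1)])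
        (use s mult_subset[OF NN d(2) QN] mult_subset[OF NN d(3) QN] Q \<psi>(3) in simp_all)
    then show "\<exists>W X \<psi>. \<psi> \<in> Hom ?N W X \<and> U \<subseteq> W \<and> Q \<subseteq> W \<and> (\<forall>x\<in>U. \<psi> x = \<phi> x) \<and> \<psi> ` Q = Q"
      using s \<psi>(2,3) by blast
  qed
qed

text \<open>
  With \<open>P = O\<^sub>p(F)\<close>, morphisms of \<open>N\<^sub>F(Q)\<close> extend to maps that stabilise \<open>Q\<close> and \<open>P\<close>, hence
  \<open>T = N\<^bsub>QP\<^esub>(Q)\<close>. So \<open>T\<close> is normal in \<open>N\<^sub>F(Q)\<close> and \<open>T \<le> O\<^sub>p(N\<^sub>F(Q)) = Q\<close>. Normalisers grow in
  \<open>p\<close>-groups, so \<open>QP = Q\<close>.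
\<close>
lemma centric_radical_contains_O_p:
  assumes Q: "Q \<in> centric_radicals F"
  shows "O_p F \<subseteq> Q"
proof -
  have Qs: "subgroup Q F" and QO: "O_p (normalizer_fs F Q) = Q" using Q by (auto simp: centric_radicals_def)
  let ?N = "normalizer_fs F Q" and ?P = "O_p F"
  interpret N: fusion_system ?N p by (rule fusion_system_normalizer_fs[OF Qs])
  note P = normal_fs_O_p
  note Ps = normal_fsD(1)[OF P]
  have QP: "subgroup (Q <#> ?P) F"
    by (rule subgroup_mult[OF Qs Ps]) (simp add: normal_fsD(3)[OF P] subgroup.subset[OF Qs])
  define T where "T = normalizer F Q \<inter> (Q <#> ?P)"
  have T: "subgroup T F" unfolding T_def by (rule subgroups_Inter_pair[OF subgroup_normalizer[OF Qs] QP])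
  note s = subset_mult[OF Qs Ps]
  have QT: "Q \<subseteq> T" using s(1) subset_normalizer[OF Qs] by (simp add: T_def)
  have "normal_fs ?N T"
  proof (rule N.normal_fsI)
    show "subgroup T ?N" using T by (simp add: subgroup_normalizer_fs[OF Qs] T_def)
    fix U V \<phi> assume \<phi>: "\<phi> \<in> Hom ?N U V"
    note d = Hom_normalizer_fsD[OF \<phi>]
    from d(4) obtain \<psi> where \<psi>: "\<psi> \<in> Hom F (U <#> Q) (V <#> Q)" "\<forall>x\<in>U. \<psi> x = \<phi> x" "\<psi> ` Q = Q" by blast
    have U: "subgroup U F" using Hom_subgroups[OF d(1)] by simp
    note s' = subset_mult[OF U Qs]
    let ?W = "U <#> Q <#> ?P" and ?X = "V <#> Q <#> ?P"
    obtain \<theta> where \<theta>: "\<theta> \<in> Hom F ?W ?X" "\<forall>x\<in>U <#> Q. \<theta> x = \<psi> x" "\<theta> ` ?P = ?P"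
      "subgroup ?W F" "U <#> Q \<subseteq> ?W" "?P \<subseteq> ?W" using normal_fs_extend[OF P \<psi>(1)] .
    have QW: "Q \<subseteq> ?W" using s'(2) \<theta>(5) by (rule subset_trans)
    have "\<theta> ` Q = \<psi> ` Q" using \<theta>(2) s'(2) by (intro image_cong refl) (simp add: subsetD)
    then have \<theta>Q: "\<theta> ` Q = Q" using \<psi>(3) by simp
    have \<theta>QP: "\<theta> ` (Q <#> ?P) = Q <#> ?P" using Hom_image_mult[OF \<theta>(1) QW \<theta>(6)] \<theta>Q \<theta>(3) by simp
    have QPW: "Q <#> ?P \<subseteq> ?W" by (rule mult_subset[OF \<theta>(4) QW \<theta>(6)])
    \<comment> \<open>The part of the domain of \<open>\<theta>\<close> on which \<open>\<theta>\<close> is a morphism of \<open>N\<^sub>F(Q)\<close>.\<close>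
    define Y where "Y = normalizer F Q \<inter> ?W"
    have Y: "subgroup Y F" unfolding Y_def by (rule subgroups_Inter_pair[OF subgroup_normalizer[OF Qs] \<theta>(4)])
    have \<theta>N: "\<theta> y \<in> normalizer F Q" if "y \<in> Y" for y
      using Hom_normalizer[OF \<theta>(1) Qs QW, of y] that \<theta>Q by (simp add: Y_def)
    have 1: "restrict \<theta> Y \<in> Hom ?N Y (normalizer F Q)"
      by (rule restrict_in_Hom_normalizer_fs[OF \<theta>(1)])
        (use Y \<theta>N Qs QW \<theta>Q subgroup_normalizer[OF Qs] in \<open>auto simp: Y_def\<close>)
    have UY: "U \<subseteq> Y" using d(2) s'(1) \<theta>(5) by (auto simp: Y_def)
    have TY: "T \<subseteq> Y" using QPW by (auto simp: Y_def T_def)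
    have "\<theta> ` T \<subseteq> T"
    proof
      fix z assume "z \<in> \<theta> ` T"
      then obtain t where t: "t \<in> T" "z = \<theta> t" by blast
      have "z \<in> normalizer F Q" using \<theta>N t TY by blast
      moreover have "z \<in> \<theta> ` (Q <#> ?P)" using t by (simp add: T_def)
      ultimately show "z \<in> T" unfolding \<theta>QP by (simp add: T_def)
    qed
    moreover have "inj_on \<theta> T" using Hom_inj[OF \<theta>(1)] QPW by (auto simp: T_def intro: inj_on_subset)
    ultimately have "\<theta> ` T = T" using endo_inj_surj[OF finite_subgroup[OF T]] by blast
    moreover have "restrict \<theta> Y ` T = \<theta> ` T" using TY by (intro image_cong refl) (simp add: subsetD)
    ultimately have 2: "restrict \<theta> Y ` T = T" by simp
    have 3: "\<forall>x\<in>U. restrict \<theta> Y x = \<phi> x" using UY \<theta>(2) \<psi>(2) s'(1) by (simp add: subsetD)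
    show "\<exists>W X \<psi>. \<psi> \<in> Hom ?N W X \<and> U \<subseteq> W \<and> T \<subseteq> W \<and> (\<forall>x\<in>U. \<psi> x = \<phi> x) \<and> \<psi> ` T = T"
      using 1 2 3 UY TY by blast
  qed
  then have "T \<subseteq> Q" using N.normal_fs_subset_O_p[of T] QO by simp
  then have "Q <#> ?P = Q" using normalizer_grows_within[OF QP Qs] s(1) unfolding T_def by blast
  then show ?thesis using s(2) by simp
qed

lemma O_p_normalizer_fs_contains: "subgroup Q F \<Longrightarrow> Q \<subseteq> O_p (normalizer_fs F Q)"
  by (rule fusion_system.normal_fs_subset_O_p[OF fusion_system_normalizer_fs normal_fs_normalizer_fs])

lemma carrier_centric_radical: "carrier F \<in> centric_radicals F"
proof -
  interpret N: fusion_system "normalizer_fs F (carrier F)" p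
    by (rule fusion_system_normalizer_fs[OF subgroup_self])
  have "O_p (normalizer_fs F (carrier F)) \<subseteq> normalizer F (carrier F)"
    using subgroup.subset[OF N.normal_fsD(1)[OF N.normal_fs_O_p]] by simp
  also have "\<dots> \<subseteq> carrier F" using subgroup.subset[OF subgroup_normalizer[OF subgroup_self]] .
  finally show ?thesis
    using O_p_normalizer_fs_contains[OF subgroup_self] subgroup_self by (simp add: centric_radicals_def)
qed

end

section \<open>Weakly centric-radical chains of length two and three\<close>

lemma centric_radical_chain_truncate: "centric_radical_chain F Q n \<Longrightarrow> m \<le> n \<Longrightarrow> centric_radical_chain F Q m"
  by (auto simp: centric_radical_chain_def)

lemma centric_radical_chain_2_unfold:
  "centric_radical_chain F Q 2 \<longleftrightarrow> subgroup (Q 0) F \<and> subgroup (Q 1) F \<and> subgroup (Q 2) F \<and>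
     Q 0 \<subset> Q 1 \<and> Q 1 \<subset> Q 2 \<and> normalizer_fs F (Q 0) = F \<and> O_p F \<subset> Q 1 \<and>
     Q 1 \<in> centric_radicals F \<and> Q 2 \<in> centric_radicals (normalizer_fs F (Q 1))"
proof -
  have "(\<forall>i\<le>2. P i) \<longleftrightarrow> P 0 \<and> P 1 \<and> P 2" "(\<forall>i<2. P i) \<longleftrightarrow> P 0 \<and> P 1" for P :: "nat \<Rightarrow> bool"
    by (auto simp: numeral_2_eq_2 le_Suc_eq less_Suc_eq)
  then show ?thesis
    by (cases "normalizer_fs F (Q 0) = F") (simp_all add: centric_radical_chain_def numeral_2_eq_2 conj_ac)
qed

lemma centric_radical_chain_3_unfold:
  "centric_radical_chain F Q 3 \<longleftrightarrow> centric_radical_chain F Q 2 \<and> subgroup (Q 3) F \<and> Q 2 \<subset> Q 3 \<and>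
     Q 3 \<in> centric_radicals (normalizer_fs (normalizer_fs F (Q 1)) (Q 2))"
proof -
  have "(\<forall>i\<le>3. P i) \<longleftrightarrow> P 0 \<and> P 1 \<and> P 2 \<and> P 3" "(\<forall>i<3. P i) \<longleftrightarrow> P 0 \<and> P 1 \<and> P 2" for P :: "nat \<Rightarrow> bool"
    by (auto simp: numeral_2_eq_2 numeral_3_eq_3 le_Suc_eq less_Suc_eq)
  then show ?thesis
    unfolding centric_radical_chain_2_unfold
    by (cases "normalizer_fs F (Q 0) = F")
      (simp_all add: centric_radical_chain_def numeral_2_eq_2 numeral_3_eq_3 conj_ac)
qed

context fusion_system
begin

lemma centric_radical_chain_length: 
  assumes "centric_radical_chain F Q n"
  shows "n \<le> card (carrier F)"
proof -
  have sub: "subgroup (Q i) F" if "i \<le> n" for i using assms that by (simp add: centric_radical_chain_def)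
  have "i \<le> n \<Longrightarrow> i \<le> card (Q i)" for i
  proof (induction i)
    case (Suc i)
    then have "Q i \<subset> Q (Suc i)" using assms by (simp add: centric_radical_chain_def)
    then have "card (Q i) < card (Q (Suc i))" using finite_subgroup[OF sub[OF Suc.prems]] by (rule psubset_card_mono[rotated])
    then show ?case using Suc by simp
  qed simp
  then have "n \<le> card (Q n)" by simp
  also have "\<dots> \<le> card (carrier F)" by (rule card_mono[OF finite_carrier subgroup.subset[OF sub[OF order_refl]]])
  finally show ?thesis .
qed

text \<open>
  Initial segments of weakly centric-radical chains are again such chains, so the lengths that
  occur form an initial segment of the natural numbers.
\<close>
lemma rank_w_eq_iff:
  "rank_w F = n \<longleftrightarrow> (\<exists>Q. centric_radical_chain F Q n) \<and> (\<nexists>Q. centric_radical_chain F Q (Suc n))"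
proof -
  let ?R = "{n. \<exists>Q. centric_radical_chain F Q n}"
  have fin: "finite ?R"
    by (rule finite_subset[of _ "{..card (carrier F)}"]) (use centric_radical_chain_length in auto)
  have "centric_radical_chain F (\<lambda>_. {\<one>}) 0"
    using normal_fsD[OF normal_fs_trivial] by (simp add: centric_radical_chain_def)
  then have ne: "?R \<noteq> {}" by blast
  show ?thesis unfolding rank_w_def
  proof
    assume M: "Max ?R = n"
    have "n \<in> ?R" using Max_in[OF fin ne] M by simp
    moreover have "Suc n \<notin> ?R" using Max_ge[OF fin, of "Suc n"] M by auto
    ultimately show "(\<exists>Q. centric_radical_chain F Q n) \<and> (\<nexists>Q. centric_radical_chain F Q (Suc n))" by simp
  next
    assume a: "(\<exists>Q. centric_radical_chain F Q n) \<and> (\<nexists>Q. centric_radical_chain F Q (Suc n))"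
    show "Max ?R = n"
    proof (rule Max_eqI[OF fin])
      fix m assume "m \<in> ?R"
      then obtain Q where Q: "centric_radical_chain F Q m" by blast
      show "m \<le> n"
      proof (rule ccontr)
        assume "\<not> m \<le> n"
        then have "centric_radical_chain F Q (Suc n)" by (intro centric_radical_chain_truncate[OF Q]) simp
        then show False using a by blast
      qed
    qed (use a in simp)
  qed
qed

lemma proper_subgroup_psubset_normalizer:
  assumes "subgroup Q F" "Q \<noteq> carrier F"
  shows "Q \<subset> normalizer F Q"
  using normalizer_grows_within[OF subgroup_self assms(1)] subset_normalizer[OF assms(1)] assms subgroup.subset[OF assms(1)] by blast

text \<open>
  A member \<open>R\<close> of \<open>F\<^sup>c\<^sup>r\<close> lies above \<open>O\<^sub>p(F)\<close>. If it is neither \<open>O\<^sub>p(F)\<close> nor \<open>S\<close>, then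
  \<open>O\<^sub>p(F) < R < N\<^sub>S(R)\<close> is a chain: the group over which a fusion system is defined is always
  weakly centric-radical in it.
\<close>
lemma chain_of_length_2_iff:
  "(\<exists>Q. centric_radical_chain F Q 2) \<longleftrightarrow> centric_radicals F - {carrier F, O_p F} \<noteq> {}"
proof
  assume "\<exists>Q. centric_radical_chain F Q 2"
  then obtain Q where c: "centric_radical_chain F Q 2" by blast
  then have "Q 1 \<in> centric_radicals F" "O_p F \<subset> Q 1" "Q 1 \<subset> Q 2" "subgroup (Q 2) F"
    by (simp_all add: centric_radical_chain_2_unfold)
  then show "centric_radicals F - {carrier F, O_p F} \<noteq> {}" using subgroup.subset[of "Q 2" F] by blast
next
  assume "centric_radicals F - {carrier F, O_p F} \<noteq> {}"
  then obtain R where R: "R \<in> centric_radicals F" "R \<noteq> carrier F" "R \<noteq> O_p F" by blast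
  have Rs: "subgroup R F" using R by (simp add: centric_radicals_def)
  have O: "O_p F \<subset> R" using centric_radical_contains_O_p[OF R(1)] R(3) by blast
  interpret N: fusion_system "normalizer_fs F R" p by (rule fusion_system_normalizer_fs[OF Rs])
  define Q where "Q = (\<lambda>i::nat. if i = 0 then O_p F else if i = 1 then R else normalizer F R)"
  have "normalizer F R \<in> centric_radicals (normalizer_fs F R)" using N.carrier_centric_radical by simp
  then have "centric_radical_chain F Q 2"
    unfolding centric_radical_chain_2_unfold Q_def
    using R(1) Rs O normal_fsD[OF normal_fs_O_p] subgroup_normalizer[OF Rs] proper_subgroup_psubset_normalizer[OF Rs R(2)]
    by simp
  then show "\<exists>Q. centric_radical_chain F Q 2" by blast
qed

text \<open>
  In the same way, a member \<open>P\<close> of \<open>N\<^sub>F(R)\<^sup>c\<^sup>r\<close> contains \<open>R\<close>; if it is neither \<open>R\<close> nor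
  \<open>N\<^sub>S(R)\<close>, it can be inserted above \<open>R\<close>, with its normaliser in \<open>N\<^sub>S(R)\<close> as last term.
\<close>
lemma chain_of_length_3_iff:
  "(\<exists>Q. centric_radical_chain F Q 3) \<longleftrightarrow>
   (\<exists>R \<in> centric_radicals F - {carrier F, O_p F}. centric_radicals (normalizer_fs F R) - {R, normalizer F R} \<noteq> {})"
proof
  assume "\<exists>Q. centric_radical_chain F Q 3"
  then obtain Q where c: "centric_radical_chain F Q 3" by blast
  then have lt: "O_p F \<subset> Q 1" "Q 1 \<subset> Q 2" "Q 2 \<subset> Q 3" and s: "subgroup (Q 1) F" "subgroup (Q 2) F"
    and c1: "Q 1 \<in> centric_radicals F" and c2: "Q 2 \<in> centric_radicals (normalizer_fs F (Q 1))"
    and c3: "Q 3 \<in> centric_radicals (normalizer_fs (normalizer_fs F (Q 1)) (Q 2))"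
    by (simp_all add: centric_radical_chain_3_unfold centric_radical_chain_2_unfold)
  from c3 have "Q 3 \<subseteq> normalizer (normalizer_fs F (Q 1)) (Q 2)"
    using subgroup.subset[of "Q 3" "normalizer_fs (normalizer_fs F (Q 1)) (Q 2)"] by (simp add: centric_radicals_def)
  also have "\<dots> \<subseteq> carrier (normalizer_fs F (Q 1))" unfolding normalizer_def stabilizer_def by blast
  also have "\<dots> = normalizer F (Q 1)" by simp
  finally have "Q 2 \<noteq> normalizer F (Q 1)" using lt by blast
  moreover have "Q 1 \<noteq> carrier F" using lt subgroup.subset[OF s(2)] by blast
  ultimately show "\<exists>R \<in> centric_radicals F - {carrier F, O_p F}. centric_radicals (normalizer_fs F R) - {R, normalizer F R} \<noteq> {}"
    using c1 c2 lt by blast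
next
  assume "\<exists>R \<in> centric_radicals F - {carrier F, O_p F}. centric_radicals (normalizer_fs F R) - {R, normalizer F R} \<noteq> {}"
  then obtain R P where R: "R \<in> centric_radicals F" "R \<noteq> carrier F" "R \<noteq> O_p F"
    and P: "P \<in> centric_radicals (normalizer_fs F R)" "P \<noteq> R" "P \<noteq> normalizer F R" by blast
  have Rs: "subgroup R F" using R by (simp add: centric_radicals_def)
  have O: "O_p F \<subset> R" using centric_radical_contains_O_p[OF R(1)] R(3) by blast
  interpret N: fusion_system "normalizer_fs F R" p by (rule fusion_system_normalizer_fs[OF Rs])
  have Ps: "subgroup P (normalizer_fs F R)" using P by (simp add: centric_radicals_def)
  interpret M: fusion_system "normalizer_fs (normalizer_fs F R) P" p by (rule N.fusion_system_normalizer_fs[OF Ps])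
  let ?T = "normalizer (normalizer_fs F R) P"
  have RP: "R \<subset> P" using O_p_normalizer_fs_contains[OF Rs] N.centric_radical_contains_O_p[OF P(1)] P(2) by blast
  have PT: "P \<subset> ?T" using N.proper_subgroup_psubset_normalizer[OF Ps] P(3) by simp
  have T: "?T \<in> centric_radicals (normalizer_fs (normalizer_fs F R) P)" using M.carrier_centric_radical by simp
  have s: "subgroup P F" "subgroup ?T F" using Ps N.subgroup_normalizer[OF Ps] subgroup_normalizer_fs[OF Rs] by auto
  define Q where "Q = (\<lambda>i::nat. if i = 0 then O_p F else if i = 1 then R else if i = 2 then P else ?T)"
  have "centric_radical_chain F Q 3"
    unfolding centric_radical_chain_3_unfold centric_radical_chain_2_unfold Q_def
    using R(1) Rs O normal_fsD[OF normal_fs_O_p] P(1) T RP PT s by simp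
  then show "\<exists>Q. centric_radical_chain F Q 3" by blast
qed

lemma rank_w_eq_2_iff:
  "rank_w F = 2 \<longleftrightarrow> centric_radicals F - {carrier F, O_p F} \<noteq> {} \<and>
    (\<forall>Q \<in> centric_radicals F - {carrier F, O_p F}.
       centric_radicals (normalizer_fs F Q) - {Q, normalizer F Q} = {})"
proof -
  have "Suc 2 = 3" by simp
  then show ?thesis unfolding rank_w_eq_iff chain_of_length_2_iff by (simp only: chain_of_length_3_iff) blast
qed

end

section \<open>Essential subgroups are weakly centric-radical\<close>

context fusion_system
begin

lemma conj_map_hom_Aut_F:
  assumes P: "subgroup P F"
  shows "group_hom (F\<lparr>carrier := normalizer F P\<rparr>) (Aut_F F P) (conj_map F P)"
proof (rule group_hom.intro)
  show "group (F\<lparr>carrier := normalizer F P\<rparr>)" using subgroup_normalizer[OF P] by (rule subgroup_imp_group)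
  show "group (Aut_F F P)" by (rule group_Aut_F[OF P])
  show "group_hom_axioms (F\<lparr>carrier := normalizer F P\<rparr>) (Aut_F F P) (conj_map F P)"
  proof (rule group_hom_axioms.intro, rule homI)
    fix g assume "g \<in> carrier (F\<lparr>carrier := normalizer F P\<rparr>)"
    then show "conj_map F P g \<in> carrier (Aut_F F P)" using conj_map_Iso[OF P] by (simp add: carrier_Aut_F)
  next
    fix g h assume "g \<in> carrier (F\<lparr>carrier := normalizer F P\<rparr>)" "h \<in> carrier (F\<lparr>carrier := normalizer F P\<rparr>)"
    then have N: "g \<in> normalizer F P" "h \<in> normalizer F P" by auto
    then have c: "g \<in> carrier F" "h \<in> carrier F" by (auto simp: mem_normalizer[OF P])
    have "conj_map F P (g \<otimes> h) = compose P (conj_map F P g) (conj_map F P h)"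
      unfolding conj_map_def compose_def
    proof (rule restrict_ext)
      fix x assume x: "x \<in> P"
      then have "h \<otimes> x \<otimes> inv h \<in> P" using N(2) by (simp add: mem_normalizer[OF P])
      then show "g \<otimes> h \<otimes> x \<otimes> inv (g \<otimes> h) =
          (\<lambda>x\<in>P. g \<otimes> x \<otimes> inv g) ((\<lambda>x\<in>P. h \<otimes> x \<otimes> inv h) x)"
        using c x subgroup.mem_carrier[OF P x] by (simp add: inv_mult_group m_assoc)
    qed
    then show "conj_map F P (g \<otimes>\<^bsub>F\<lparr>carrier := normalizer F P\<rparr>\<^esub> h) = conj_map F P g \<otimes>\<^bsub>Aut_F F P\<^esub> conj_map F P h"
      using mult_Aut_F[OF conj_map_Iso[OF P N(1)] conj_map_Iso[OF P N(2)]] by simp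
  qed
qed

text \<open>
  The rule \<open>\<phi> c\<^sub>r \<phi>\<inverse> = c\<^bsub>\<psi>(r)\<^esub>\<close>, for an extension \<open>\<psi>\<close> of \<open>\<phi>\<close> that is defined at \<open>r\<close>.
\<close>
lemma conj_map_transport:
  assumes P: "subgroup P F" and \<phi>: "\<phi> \<in> Iso F P P" and \<psi>: "\<psi> \<in> Hom F W X" "P \<subseteq> W" "\<And>x. x \<in> P \<Longrightarrow> \<psi> x = \<phi> x"
    and r: "r \<in> W" "r \<in> normalizer F P"
  shows "\<phi> \<otimes>\<^bsub>Aut_F F P\<^esub> conj_map F P r \<otimes>\<^bsub>Aut_F F P\<^esub> inv\<^bsub>Aut_F F P\<^esub> \<phi> = conj_map F P (\<psi> r)"
    and "\<psi> r \<in> normalizer F P"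
proof -
  interpret A: group "Aut_F F P" by (rule group_Aut_F[OF P])
  have W: "subgroup W F" using Hom_subgroups[OF \<psi>(1)] by simp
  have "\<psi> ` P = \<phi> ` P" using \<psi>(3) by (rule image_cong[OF refl])
  then have "\<psi> ` P = P" using \<phi> by (simp add: Iso_altdef)
  then show N: "\<psi> r \<in> normalizer F P" using Hom_normalizer[OF \<psi>(1) P \<psi>(2) r] by simp
  have m: "\<phi> x \<in> P" if "x \<in> P" for x using \<phi> that by (auto simp: Iso_altdef)
  note c = conj_map_Iso[OF P r(2)] and d = conj_map_Iso[OF P N]
  have "compose P \<phi> (conj_map F P r) = compose P (conj_map F P (\<psi> r)) \<phi>"
    unfolding compose_def
  proof (rule restrict_ext)
    fix x assume x: "x \<in> P"
    have xW: "x \<in> W" using x \<psi>(2) by blast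
    have rx: "r \<otimes> x \<otimes> inv r \<in> P" using r(2) x by (simp add: mem_normalizer[OF P])
    have "\<phi> (conj_map F P r x) = \<psi> (r \<otimes> x \<otimes> inv r)" using x \<psi>(3)[OF rx] by (simp add: conj_map_def)
    also have "\<dots> = \<psi> r \<otimes> \<psi> x \<otimes> inv \<psi> r"
      using Hom_mult[OF \<psi>(1)] Hom_inv[OF \<psi>(1)] r(1) xW W by (simp add: subgroup.m_closed subgroup.m_inv_closed)
    also have "\<dots> = conj_map F P (\<psi> r) (\<phi> x)" using m[OF x] \<psi>(3)[OF x] by (simp add: conj_map_def)
    finally show "\<phi> (conj_map F P r x) = conj_map F P (\<psi> r) (\<phi> x)" .
  qed
  then have "\<phi> \<otimes>\<^bsub>Aut_F F P\<^esub> conj_map F P r = conj_map F P (\<psi> r) \<otimes>\<^bsub>Aut_F F P\<^esub> \<phi>"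
    using mult_Aut_F \<phi> c d by simp
  then show "\<phi> \<otimes>\<^bsub>Aut_F F P\<^esub> conj_map F P r \<otimes>\<^bsub>Aut_F F P\<^esub> inv\<^bsub>Aut_F F P\<^esub> \<phi> = conj_map F P (\<psi> r)"
    using \<phi> c d unfolding carrier_Aut_F[of P, symmetric] by (simp add: A.m_assoc)
qed

lemma conj_maps_normal_in_Aut_F:
  assumes P: "subgroup P F" and R: "subgroup R F" "R \<subseteq> normalizer F P"
    and ext: "\<And>\<phi>. \<phi> \<in> Iso F P P \<Longrightarrow> \<exists>W X \<psi>. \<psi> \<in> Hom F W X \<and> P \<subseteq> W \<and> R \<subseteq> W \<and> (\<forall>x\<in>P. \<psi> x = \<phi> x) \<and> \<psi> ` R = R"
  shows "conj_map F P ` R \<lhd> Aut_F F P"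
proof (rule group.normal_invI[OF group_Aut_F[OF P]])
  interpret c: group_hom "F\<lparr>carrier := normalizer F P\<rparr>" "Aut_F F P" "conj_map F P" by (rule conj_map_hom_Aut_F[OF P])
  show "subgroup (conj_map F P ` R) (Aut_F F P)"
    by (rule c.subgroup_img_is_subgroup[OF subgroup_incl[OF R(1) subgroup_normalizer[OF P] R(2)]])
  fix \<phi> f assume "\<phi> \<in> carrier (Aut_F F P)" and f: "f \<in> conj_map F P ` R"
  then have \<phi>: "\<phi> \<in> Iso F P P" by (simp add: carrier_Aut_F)
  from f obtain r where r: "r \<in> R" "f = conj_map F P r" by blast
  from ext[OF \<phi>] obtain W X \<psi> where \<psi>: "\<psi> \<in> Hom F W X" "P \<subseteq> W" "R \<subseteq> W" "\<forall>x\<in>P. \<psi> x = \<phi> x" "\<psi> ` R = R" by blast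
  have "\<phi> \<otimes>\<^bsub>Aut_F F P\<^esub> f \<otimes>\<^bsub>Aut_F F P\<^esub> inv\<^bsub>Aut_F F P\<^esub> \<phi> = conj_map F P (\<psi> r)"
    unfolding r(2) using \<psi>(3,4) r(1) R(2) by (intro conj_map_transport(1)[OF P \<phi> \<psi>(1,2)]) (auto simp: subset_iff)
  moreover have "\<psi> r \<in> R" using \<psi>(5) r(1) by blast
  ultimately show "\<phi> \<otimes>\<^bsub>Aut_F F P\<^esub> f \<otimes>\<^bsub>Aut_F F P\<^esub> inv\<^bsub>Aut_F F P\<^esub> \<phi> \<in> conj_map F P ` R" by simp
qed

lemma p_subgroup_conj_maps:
  assumes P: "subgroup P F" and R: "subgroup R F" "R \<subseteq> normalizer F P"
  shows "p_subgroup p (Aut_F F P) (conj_map F P ` R)"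
proof -
  have "p_subgroup p (F\<lparr>carrier := normalizer F P\<rparr>) R"
    using subgroup_p_subgroup[OF R(1)] subgroup_incl[OF R(1) subgroup_normalizer[OF P] R(2)] by (simp add: p_subgroup_def)
  then show ?thesis by (rule group_hom.p_subgroup_image[OF conj_map_hom_Aut_F[OF P] prime_p])
qed

lemma Inn_normal: "subgroup P F \<Longrightarrow> Inn F P \<lhd> Aut_F F P"
  unfolding Inn_def
proof (rule conj_maps_normal_in_Aut_F)
  fix \<phi> assume "\<phi> \<in> Iso F P P"
  then show "\<exists>W X \<psi>. \<psi> \<in> Hom F W X \<and> P \<subseteq> W \<and> P \<subseteq> W \<and> (\<forall>x\<in>P. \<psi> x = \<phi> x) \<and> \<psi> ` P = P"
    by (intro exI[of _ P] exI[of _ \<phi>]) (simp add: Iso_altdef)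
qed (simp_all add: subset_normalizer)

text \<open>
  Elements that act equally on \<open>P\<close> differ by an element of \<open>C\<^sub>S(P)\<close>.
\<close>
lemma conj_map_eq_imp:
  assumes P: "subgroup P F" and g: "g \<in> carrier F" and e: "e \<in> P" and eq: "conj_map F P g = conj_map F P e"
    and C: "centralizer F P \<subseteq> P"
  shows "g \<in> P"
proof -
  have ec: "e \<in> carrier F" using e P by (simp add: subgroup.mem_carrier)
  have "inv e \<otimes> g \<in> centralizer F P" unfolding centralizer_def
  proof (intro CollectI conjI ballI)
    show "inv e \<otimes> g \<in> carrier F" using g ec by simp
    fix x assume x: "x \<in> P"
    have xc: "x \<in> carrier F" using x P by (simp add: subgroup.mem_carrier)
    have "conj_map F P g x = conj_map F P e x" using eq by simp
    then have "g \<otimes> x \<otimes> inv g = e \<otimes> x \<otimes> inv e" using x by (simp add: conj_map_def)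
    then have "g \<otimes> x = e \<otimes> x \<otimes> inv e \<otimes> g" using g xc ec by (metis inv_solve_right m_closed inv_closed)
    then have "inv e \<otimes> (g \<otimes> x) = inv e \<otimes> (e \<otimes> (x \<otimes> (inv e \<otimes> g)))" using g xc ec by (simp add: m_assoc)
    then show "inv e \<otimes> g \<otimes> x = x \<otimes> (inv e \<otimes> g)" using g xc ec by (simp add: m_assoc[symmetric])
  qed
  then have "e \<otimes> (inv e \<otimes> g) \<in> P" using C e P by (meson subgroup.m_closed subsetD)
  then show ?thesis using g ec by (simp add: m_assoc[symmetric])
qed

lemma centric_centralizer_subset:
  assumes "subgroup P F" "centric F P"
  shows "centralizer F P \<subseteq> P"
proof -
  have "F_conjugate F P P" using Iso_id[OF assms(1)] by (auto simp: F_conjugate_def)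
  then have "centralizer F P = center (F\<lparr>carrier := P\<rparr>)" using assms(2) by (simp add: centric_def)
  then show ?thesis by (auto simp: center_def centralizer_def)
qed

text \<open>
  Let \<open>R = O\<^sub>p(N\<^sub>F(E))\<close>. Every automorphism of \<open>E\<close> in \<open>F\<close> lies in \<open>N\<^sub>F(E)\<close> and so extends to
  a map that stabilises \<open>R\<close>. Hence \<open>Aut\<^sub>R(E)\<close> is a normal \<open>p\<close>-subgroup of \<open>Aut\<^sub>F(E)\<close>, and the strongly
  embedded subgroup of \<open>Out\<^sub>F(E)\<close> forces \<open>Aut\<^sub>R(E) \<le> Inn(E)\<close>, that is, \<open>R \<le> E C\<^sub>S(E) = E\<close>.
\<close>
lemma essential_centric_radical:
  assumes E: "E \<in> essentials p F"
  shows "E \<in> centric_radicals F"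
proof -
  have Es: "subgroup E F" and cen: "centric F E" using E by (auto simp: essentials_def)
  obtain H where H: "strongly_embedded p (Aut_F F E Mod Inn F E) H"
    using E by (auto simp: essentials_def Out_F_def)
  interpret A: group "Aut_F F E" by (rule group_Aut_F[OF Es])
  let ?N = "normalizer_fs F E"
  interpret N: fusion_system ?N p by (rule fusion_system_normalizer_fs[OF Es])
  define R where "R = O_p ?N"
  have nR: "normal_fs ?N R" unfolding R_def by (rule N.normal_fs_O_p)
  have R: "subgroup R F" "R \<subseteq> normalizer F E"
    using N.normal_fsD(1)[OF nR] by (simp_all add: subgroup_normalizer_fs[OF Es])
  have "conj_map F E ` R \<lhd> Aut_F F E"
  proof (rule conj_maps_normal_in_Aut_F[OF Es R])
    fix \<phi> assume "\<phi> \<in> Iso F E E"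
    then have \<phi>: "\<phi> \<in> Hom F E E" "\<phi> ` E = E" by (simp_all add: Iso_altdef)
    have "\<phi> \<in> Hom ?N E E"
      by (rule Hom_normalizer_fsI[OF \<phi>(1) \<phi>(1)]) (use \<phi>(2) Es subset_normalizer[OF Es] in simp_all)
    from N.normal_fs_extend[OF nR this]
    obtain \<psi> where \<psi>: "\<psi> \<in> Hom ?N (E <#> R) (E <#> R)" "\<forall>x\<in>E. \<psi> x = \<phi> x" "\<psi> ` R = R" by (metis set_mult_normalizer_fs)
    then show "\<exists>W X \<psi>. \<psi> \<in> Hom F W X \<and> E \<subseteq> W \<and> R \<subseteq> W \<and> (\<forall>x\<in>E. \<psi> x = \<phi> x) \<and> \<psi> ` R = R"
      using Hom_normalizer_fsD(1)[OF \<psi>(1)] subset_mult[OF Es R(1)] by blast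
  qed
  then have sub: "conj_map F E ` R \<subseteq> Inn F E"
    by (rule A.strongly_embedded_Mod_imp_normal_p_subgroup_subset
        [OF finite_Aut_F[OF Es] prime_p Inn_normal[OF Es] H _ p_subgroup_conj_maps[OF Es R]])
  have "R \<subseteq> E"
  proof
    fix r assume r: "r \<in> R"
    then obtain e where "e \<in> E" "conj_map F E r = conj_map F E e" using sub by (auto simp: Inn_def)
    then show "r \<in> E"
      using conj_map_eq_imp[OF Es subgroup.mem_carrier[OF R(1) r]] centric_centralizer_subset[OF Es cen] by blast
  qed
  then show ?thesis using O_p_normalizer_fs_contains[OF Es] Es by (auto simp: centric_radicals_def R_def)
qed

end

context saturated_fusion_system
begin

text \<open>
  By saturation \<open>Aut\<^sub>S(S) = Inn(S)\<close> is a Sylow subgroup of \<open>Aut\<^sub>F(S)\<close>, so \<open>Out\<^sub>F(S)\<close> has order prime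
  to \<open>p\<close>, whereas the order of a strongly embedded subgroup is divisible by \<open>p\<close>.
\<close>
lemma carrier_not_essential: "carrier F \<notin> essentials p F"
proof
  assume "carrier F \<in> essentials p F"
  then obtain H where H: "strongly_embedded p (Aut_F F (carrier F) Mod Inn F (carrier F)) H"
    by (auto simp: essentials_def Out_F_def)
  let ?A = "Aut_F F (carrier F)" and ?I = "Inn F (carrier F)"
  interpret A: group ?A by (rule group_Aut_F[OF subgroup_self])
  note I = Inn_normal[OF subgroup_self]
  interpret O: group "?A Mod ?I" by (rule normal.factorgroup_is_group[OF I])
  obtain Q where Q: "F_conjugate F (carrier F) Q" "fully_automised p F Q" using saturated[OF subgroup_self] by blast
  obtain \<phi> where \<phi>: "\<phi> \<in> Iso F (carrier F) Q" using Q(1) by (auto simp: F_conjugate_def)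
  have Qs: "subgroup Q F" using Hom_subgroups[OF IsoD(1)[OF \<phi>]] by simp
  have "Q = carrier F" by (rule card_subset_eq[OF finite_carrier subgroup.subset[OF Qs] Iso_card[OF \<phi>, symmetric]])
  moreover have "normalizer F (carrier F) = carrier F"
    using subset_normalizer[OF subgroup_self] subgroup.subset[OF subgroup_normalizer[OF subgroup_self]] by blast
  ultimately have cI: "card ?I = p ^ multiplicity p (order ?A)"
    using Q(2) by (simp add: fully_automised_def sylow_subgroup_def Aut_S_def Inn_def)
  have lag: "order (?A Mod ?I) * card ?I = order ?A"
    using A.lagrange[OF normal_imp_subgroup[OF I]] by (simp add: order_def FactGroup_def)
  have "order ?A \<noteq> 0" using finite_Aut_F[OF subgroup_self] A.order_gt_0_iff_finite by simp
  have Hs: "subgroup H (?A Mod ?I)" "p dvd card H" using H by (auto simp: strongly_embedded_def)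
  have "card H dvd order (?A Mod ?I)" using O.lagrange[OF Hs(1)] by (metis dvd_triv_right)
  then have "p dvd order (?A Mod ?I)" using Hs(2) dvd_trans by blast
  then have "p ^ Suc (multiplicity p (order ?A)) dvd order ?A"
    using lag cI by (metis mult_dvd_mono dvd_refl power_Suc)
  then show False using prime_p \<open>order ?A \<noteq> 0\<close>
    by (metis multiplicity_geI not_less_eq_eq not_prime_unit order_refl)
qed

end

section \<open>Extending isomorphisms onto fully automised, receptive subgroups\<close>

lemma (in group) sylow_subgroup_in_subgroup:
  assumes fin: "finite (carrier G)" and p: "prime p" and T: "sylow_subgroup p G T" and H: "subgroup H G" "T \<subseteq> H"
  shows "sylow_subgroup p (G\<lparr>carrier := H\<rparr>) T"
proof -
  have Ts: "subgroup T G" and Tc: "card T = p ^ multiplicity p (order G)" using T by (auto simp: sylow_subgroup_def)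
  have G0: "order G \<noteq> 0" using fin order_gt_0_iff_finite by simp
  have HG: "card H dvd order G" using lagrange[OF H(1)] by (metis dvd_triv_right)
  then have H0: "card H \<noteq> 0" using G0 by (metis dvd_0_left)
  have "p ^ multiplicity p (order G) dvd card H" using card_subgroup_dvd[OF H(1) Ts H(2)] Tc by simp
  then have "multiplicity p (order G) \<le> multiplicity p (card H)"
    using p H0 by (intro multiplicity_geI) (auto simp: not_prime_unit)
  moreover have "multiplicity p (card H) \<le> multiplicity p (order G)"
    using dvd_imp_multiplicity_le[OF HG G0] .
  ultimately show ?thesis using Tc subgroup_incl[OF Ts H] by (simp add: sylow_subgroup_def order_def)
qed

lemma (in group) p_subgroup_conjugate:
  assumes "prime p" "g \<in> carrier G" "p_subgroup p G Q"
  shows "p_subgroup p G ((\<lambda>x. inv g \<otimes> x \<otimes> g) ` Q)"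
proof -
  have "inv g \<otimes> (x \<otimes> y) \<otimes> g = (inv g \<otimes> x \<otimes> g) \<otimes> (inv g \<otimes> y \<otimes> g)" if "x \<in> carrier G" "y \<in> carrier G" for x y
  proof -
    have "(inv g \<otimes> x \<otimes> g) \<otimes> (inv g \<otimes> y \<otimes> g) = inv g \<otimes> x \<otimes> (g \<otimes> inv g) \<otimes> y \<otimes> g"
      using assms(2) that by (simp only: m_assoc m_closed inv_closed)
    then show ?thesis using assms(2) that by (simp add: m_assoc)
  qed
  then have "group_hom G G (\<lambda>x. inv g \<otimes> x \<otimes> g)"
    using assms(2) by (simp add: group_hom_def group_hom_axioms_def hom_def is_group)
  then show ?thesis by (rule group_hom.p_subgroup_image[OF _ assms(1,3)])
qed

context fusion_system
begin

lemma Iso_inv: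
  assumes "\<phi> \<in> Iso F P Q"
  obtains \<psi> where "\<psi> \<in> Iso F Q P" "\<And>x. x \<in> P \<Longrightarrow> \<psi> (\<phi> x) = x" "\<And>y. y \<in> Q \<Longrightarrow> \<phi> (\<psi> y) = y"
proof
  show "restrict (inv_into P \<phi>) Q \<in> Iso F Q P" by (rule IsoD(3)[OF assms])
  note im = IsoD(2)[OF assms] and inj = Hom_inj[OF IsoD(1)[OF assms]]
  show "restrict (inv_into P \<phi>) Q (\<phi> x) = x" if "x \<in> P" for x using that im inj by auto
  show "\<phi> (restrict (inv_into P \<phi>) Q y) = y" if "y \<in> Q" for y using that im by (auto simp: f_inv_into_f)
qed

lemma Iso_maps: "\<phi> \<in> Iso F P Q \<Longrightarrow> x \<in> P \<Longrightarrow> \<phi> x \<in> Q"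
  using Hom_maps[OF IsoD(1)] .

lemma conjugation_by_iso_hom:
  assumes R: "subgroup R F" and Z: "subgroup Z F" and \<chi>: "\<chi> \<in> Iso F R Z"
    and \<chi>': "\<chi>' \<in> Iso F Z R" "\<And>x. x \<in> R \<Longrightarrow> \<chi>' (\<chi> x) = x"
  shows "group_hom (Aut_F F R) (Aut_F F Z) (\<lambda>f. compose Z (compose R \<chi> f) \<chi>')"
proof (rule group_hom.intro)
  let ?\<tau> = "\<lambda>f. compose Z (compose R \<chi> f) \<chi>'"
  show "group (Aut_F F R)" "group (Aut_F F Z)" using R Z by (simp_all add: group_Aut_F)
  have cl: "?\<tau> f \<in> Iso F Z Z" if "f \<in> Iso F R R" for f
    by (rule Iso_compose[OF \<chi>'(1) Iso_compose[OF that \<chi>]])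
  show "group_hom_axioms (Aut_F F R) (Aut_F F Z) ?\<tau>"
  proof (rule group_hom_axioms.intro, rule homI)
    fix f assume "f \<in> carrier (Aut_F F R)"
    then show "?\<tau> f \<in> carrier (Aut_F F Z)" using cl by (simp add: carrier_Aut_F)
  next
    fix f g assume "f \<in> carrier (Aut_F F R)" "g \<in> carrier (Aut_F F R)"
    then have fg: "f \<in> Iso F R R" "g \<in> Iso F R R" by (simp_all add: carrier_Aut_F)
    have "?\<tau> (compose R f g) = compose Z (?\<tau> f) (?\<tau> g)"
    proof (rule extensionalityI[of _ Z])
      fix y assume y: "y \<in> Z"
      note 1 = Iso_maps[OF \<chi>'(1) y]
      note 2 = Iso_maps[OF fg(2) 1]
      show "?\<tau> (compose R f g) y = compose Z (?\<tau> f) (?\<tau> g) y"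
        using y 1 2 \<chi>'(2)[OF 2] Iso_maps[OF \<chi> 2] by (simp add: compose_def)
    qed simp_all
    then show "?\<tau> (f \<otimes>\<^bsub>Aut_F F R\<^esub> g) = ?\<tau> f \<otimes>\<^bsub>Aut_F F Z\<^esub> ?\<tau> g"
      by (simp add: mult_Aut_F fg cl)
  qed
qed

text \<open>
  \<open>\<chi> Aut\<^sub>S(R) \<chi>\<inverse>\<close> is a \<open>p\<close>-subgroup of \<open>Aut\<^sub>F(Z)\<close>, so some \<open>\<alpha>\<close> conjugates it into the Sylow
  subgroup \<open>Aut\<^sub>S(Z)\<close>. Then the extender of \<open>\<alpha>\<chi>\<close> is the whole of \<open>N\<^sub>S(R)\<close>.
\<close>
lemma fully_automised_receptive_extend_to_normalizer:
  assumes Z: "fully_automised p F Z" "receptive F Z" and \<chi>: "\<chi> \<in> Iso F R Z"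
  shows "\<exists>\<alpha> \<in> Iso F Z Z. \<exists>\<psi> \<in> Hom F (normalizer F R) (carrier F). \<forall>x\<in>R. \<psi> x = \<alpha> (\<chi> x)"
proof -
  have R: "subgroup R F" and Zs: "subgroup Z F" using Hom_subgroups[OF IsoD(1)[OF \<chi>]] by auto
  interpret A: group "Aut_F F Z" by (rule group_Aut_F[OF Zs])
  obtain \<chi>' where \<chi>': "\<chi>' \<in> Iso F Z R" "\<And>x. x \<in> R \<Longrightarrow> \<chi>' (\<chi> x) = x" "\<And>y. y \<in> Z \<Longrightarrow> \<chi> (\<chi>' y) = y"
    using Iso_inv[OF \<chi>] by blast
  \<comment> \<open>Conjugation by \<open>\<chi>\<close>, as a map \<open>Aut\<^sub>F(R) \<rightarrow> Aut\<^sub>F(Z)\<close>.\<close>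
  define \<tau> where "\<tau> = (\<lambda>f. compose Z (compose R \<chi> f) \<chi>')"
  have hom: "group_hom (Aut_F F R) (Aut_F F Z) \<tau>" unfolding \<tau>_def by (rule conjugation_by_iso_hom[OF R Zs \<chi> \<chi>'(1,2)])
  have "p_subgroup p (Aut_F F R) (conj_map F R ` normalizer F R)"
    by (rule p_subgroup_conj_maps[OF R subgroup_normalizer[OF R] subset_refl])
  then have P: "p_subgroup p (Aut_F F Z) (\<tau> ` conj_map F R ` normalizer F R)"
    by (rule group_hom.p_subgroup_image[OF hom prime_p])
  have T: "sylow_subgroup p (Aut_F F Z) (Aut_S F Z)" using Z(1) by (simp add: fully_automised_def)
  obtain \<alpha> where "\<alpha> \<in> carrier (Aut_F F Z)"
    and \<alpha>T: "\<forall>x\<in>\<tau> ` conj_map F R ` normalizer F R. \<alpha> \<otimes>\<^bsub>Aut_F F Z\<^esub> x \<otimes>\<^bsub>Aut_F F Z\<^esub> inv\<^bsub>Aut_F F Z\<^esub> \<alpha> \<in> Aut_S F Z"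
    using A.p_subgroup_conj_into_sylow[OF finite_Aut_F[OF Zs] prime_p T P] by blast
  then have \<alpha>: "\<alpha> \<in> Iso F Z Z" by (simp add: carrier_Aut_F)
  define \<kappa> where "\<kappa> = compose R \<alpha> \<chi>"
  have \<kappa>: "\<kappa> \<in> Iso F R Z" unfolding \<kappa>_def by (rule Iso_compose[OF \<chi> \<alpha>])
  have \<kappa>x: "\<kappa> x = \<alpha> (\<chi> x)" if "x \<in> R" for x using that by (simp add: \<kappa>_def compose_def)
  have "g \<in> extender F R Z \<kappa>" if g: "g \<in> normalizer F R" for g
  proof -
    let ?c = "conj_map F R g"
    have c: "?c \<in> Iso F R R" by (rule conj_map_Iso[OF R g])
    have tc: "\<tau> ?c \<in> Iso F Z Z" unfolding \<tau>_def by (rule Iso_compose[OF \<chi>'(1) Iso_compose[OF c \<chi>]])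
    obtain \<beta> where \<beta>: "\<beta> \<in> Iso F Z Z" "\<beta> = inv\<^bsub>Aut_F F Z\<^esub> \<alpha>" "\<And>y. y \<in> Z \<Longrightarrow> \<beta> (\<alpha> y) = y"
      using inv_Aut_F[OF Zs \<alpha>] IsoD(3)[OF \<alpha>] Hom_inj[OF IsoD(1)[OF \<alpha>]] Iso_maps[OF \<alpha>] by fastforce
    have eq: "\<alpha> \<otimes>\<^bsub>Aut_F F Z\<^esub> \<tau> ?c \<otimes>\<^bsub>Aut_F F Z\<^esub> inv\<^bsub>Aut_F F Z\<^esub> \<alpha> = compose Z (compose Z \<alpha> (\<tau> ?c)) \<beta>"
      using \<beta>(1) \<alpha> tc Iso_compose[OF tc \<alpha>] unfolding \<beta>(2)[symmetric] by (simp add: mult_Aut_F)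
    have "(\<lambda>y\<in>Z. \<kappa> (?c (inv_into R \<kappa> y))) = compose Z (compose Z \<alpha> (\<tau> ?c)) \<beta>"
    proof (rule extensionalityI[of _ Z])
      fix y assume y: "y \<in> Z"
      then obtain x where x: "x \<in> R" "y = \<kappa> x" using IsoD(2)[OF \<kappa>] by blast
      have \<chi>x: "\<chi> x \<in> Z" by (rule Iso_maps[OF \<chi> x(1)])
      have cx: "?c x \<in> R" by (rule Iso_maps[OF c x(1)])
      have \<beta>y: "\<beta> y = \<chi> x" using x \<chi>x \<beta>(3) \<kappa>x by simp
      have "inv_into R \<kappa> y = x" using x Hom_inj[OF IsoD(1)[OF \<kappa>]] by simp
      then have "(\<lambda>y\<in>Z. \<kappa> (?c (inv_into R \<kappa> y))) y = \<alpha> (\<chi> (?c x))" using y \<kappa>x[OF cx] by simp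
      also have "\<dots> = \<alpha> (\<tau> ?c (\<chi> x))" using \<chi>x x(1) \<chi>'(2)[OF x(1)] by (simp add: \<tau>_def compose_def)
      also have "\<dots> = compose Z (compose Z \<alpha> (\<tau> ?c)) \<beta> y" using y \<beta>y \<chi>x by (simp add: compose_def)
      finally show "(\<lambda>y\<in>Z. \<kappa> (?c (inv_into R \<kappa> y))) y = compose Z (compose Z \<alpha> (\<tau> ?c)) \<beta> y" .
    qed simp_all
    moreover have "\<alpha> \<otimes>\<^bsub>Aut_F F Z\<^esub> \<tau> ?c \<otimes>\<^bsub>Aut_F F Z\<^esub> inv\<^bsub>Aut_F F Z\<^esub> \<alpha> \<in> Aut_S F Z" using \<alpha>T g by blast
    ultimately show ?thesis using g eq by (simp add: extender_def)
  qed
  then have "extender F R Z \<kappa> = normalizer F R" by (auto simp: extender_def)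
  then obtain \<psi> where \<psi>: "\<psi> \<in> Hom F (normalizer F R) (carrier F)" "restrict \<psi> R = \<kappa>"
    using Z(2) \<kappa> unfolding receptive_def by metis
  have "\<psi> x = \<alpha> (\<chi> x)" if "x \<in> R" for x using that \<kappa>x[OF that] \<psi>(2) by (metis restrict_apply')
  then show ?thesis using \<alpha> \<psi>(1) by blast
qed

lemma fully_automised_receptive_normalizer_embedding:
  assumes Z: "fully_automised p F Z" "receptive F Z" and R: "F_conjugate F Z R"
  obtains \<psi> where "\<psi> \<in> Hom F (normalizer F R) (carrier F)" "\<psi> ` R = Z" "subgroup R F" "subgroup Z F"
proof -
  obtain \<chi>0 where \<chi>0: "\<chi>0 \<in> Iso F Z R" using R by (auto simp: F_conjugate_def)
  define \<chi> where "\<chi> = restrict (inv_into Z \<chi>0) R"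
  have \<chi>i: "\<chi> \<in> Iso F R Z" unfolding \<chi>_def by (rule IsoD(3)[OF \<chi>0])
  obtain \<alpha> \<psi> where \<alpha>: "\<alpha> \<in> Iso F Z Z" and \<psi>: "\<psi> \<in> Hom F (normalizer F R) (carrier F)" "\<forall>x\<in>R. \<psi> x = \<alpha> (\<chi> x)"
    using fully_automised_receptive_extend_to_normalizer[OF Z \<chi>i] by blast
  have "\<psi> ` R = \<alpha> ` \<chi> ` R" using \<psi>(2) by (simp add: image_image)
  also have "\<dots> = Z" using IsoD(2)[OF \<chi>i] IsoD(2)[OF \<alpha>] by simp
  finally show ?thesis using that[OF \<psi>(1)] Hom_subgroups[OF IsoD(1)[OF \<chi>0]] by blast
qed

lemma fully_automised_receptive_imp_fully_normalised:
  assumes Z: "fully_automised p F Z" "receptive F Z"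
  shows "fully_normalised F Z"
  unfolding fully_normalised_def
proof (intro allI impI)
  fix R assume "F_conjugate F Z R"
  from fully_automised_receptive_normalizer_embedding[OF Z this]
  obtain \<psi> where \<psi>: "\<psi> \<in> Hom F (normalizer F R) (carrier F)" "\<psi> ` R = Z" and R: "subgroup R F" and Zs: "subgroup Z F" .
  have "\<psi> w \<in> normalizer F Z" if "w \<in> normalizer F R" for w
    using Hom_normalizer[OF \<psi>(1) R subset_normalizer[OF R] that that] \<psi>(2) by simp
  then show "card (normalizer F R) \<le> card (normalizer F Z)"
    using card_inj_on_le[OF Hom_inj[OF \<psi>(1)]] finite_subgroup[OF subgroup_normalizer[OF Zs]] by blast
qed

text \<open>
  The embedding of \<open>N\<^sub>S(R)\<close> that takes \<open>R\<close> to \<open>Z\<close> takes \<open>C\<^sub>S(R)\<close> into \<open>C\<^sub>S(Z) \<le> Z\<close>.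
\<close>
lemma fully_automised_receptive_imp_centric:
  assumes Z: "fully_automised p F Z" "receptive F Z" and C: "centralizer F Z \<subseteq> Z"
  shows "centric F Z"
  unfolding centric_def
proof (intro allI impI)
  fix R assume "F_conjugate F Z R"
  from fully_automised_receptive_normalizer_embedding[OF Z this]
  obtain \<psi> where \<psi>: "\<psi> \<in> Hom F (normalizer F R) (carrier F)" "\<psi> ` R = Z" and R: "subgroup R F" and Zs: "subgroup Z F" .
  note RN = subset_normalizer[OF R]
  have "centralizer F R \<subseteq> R"
  proof
    fix c assume c: "c \<in> centralizer F R"
    then have cc: "c \<in> carrier F" and comm: "\<And>x. x \<in> R \<Longrightarrow> c \<otimes> x = x \<otimes> c" by (auto simp: centralizer_def)
    have "c \<otimes> x \<otimes> inv c = x" if "x \<in> R" for x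
      using comm[OF that] cc subgroup.mem_carrier[OF R that] by (simp add: m_assoc)
    then have cN: "c \<in> normalizer F R" using cc by (simp add: mem_normalizer[OF R])
    have "\<psi> c \<in> centralizer F Z" unfolding centralizer_def
    proof (intro CollectI conjI ballI)
      show "\<psi> c \<in> carrier F" by (rule Hom_maps[OF \<psi>(1) cN])
      fix z assume "z \<in> Z"
      then obtain x where x: "x \<in> R" "z = \<psi> x" using \<psi>(2) by blast
      have xN: "x \<in> normalizer F R" using x RN by blast
      show "\<psi> c \<otimes> z = z \<otimes> \<psi> c"
        using Hom_mult[OF \<psi>(1) cN xN] Hom_mult[OF \<psi>(1) xN cN] comm[OF x(1)] x(2) by simp
    qed
    then have "\<psi> c \<in> \<psi> ` R" using C \<psi>(2) by blast
    then show "c \<in> R" using Hom_inj[OF \<psi>(1)] cN RN by (meson inj_on_image_mem_iff)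
  qed
  then show "centralizer F R = center (F\<lparr>carrier := R\<rparr>)"
    using subgroup.subset[OF R] by (auto simp: center_def centralizer_def)
qed

end

section \<open>Morphisms that extend to automorphisms of \<open>S\<close>\<close>

context fusion_system
begin

definition extends_to_carrier :: "'a set \<Rightarrow> ('a \<Rightarrow> 'a) \<Rightarrow> bool" where
  "extends_to_carrier X \<phi> \<longleftrightarrow> (\<exists>\<alpha> \<in> Iso F (carrier F) (carrier F). \<forall>x\<in>X. \<alpha> x = \<phi> x)"

lemma subgroup_extending_automorphisms:
  assumes Z: "subgroup Z F"
  shows "subgroup {\<gamma> \<in> Iso F Z Z. extends_to_carrier Z \<gamma>} (Aut_F F Z)"
proof (rule group.subgroupI[OF group_Aut_F[OF Z]])
  let ?H = "{\<gamma> \<in> Iso F Z Z. extends_to_carrier Z \<gamma>}"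
  note Zsub = subgroup.subset[OF Z]
  show "?H \<subseteq> carrier (Aut_F F Z)" by (auto simp: carrier_Aut_F)
  have "(\<lambda>x\<in>Z. x) \<in> ?H"
    using Iso_id[OF Z] Iso_id[OF subgroup_self] Zsub unfolding extends_to_carrier_def
    by (auto intro!: bexI[of _ "\<lambda>x\<in>carrier F. x"])
  then show "?H \<noteq> {}" by blast
  show "inv\<^bsub>Aut_F F Z\<^esub> \<gamma> \<in> ?H" if "\<gamma> \<in> ?H" for \<gamma>
  proof -
    from that have \<gamma>: "\<gamma> \<in> Iso F Z Z" by simp
    from that obtain \<alpha> where \<alpha>: "\<alpha> \<in> Iso F (carrier F) (carrier F)" "\<forall>x\<in>Z. \<alpha> x = \<gamma> x" by (auto simp: extends_to_carrier_def)
    obtain \<beta> where \<beta>: "\<beta> \<in> Iso F (carrier F) (carrier F)" "\<And>x. x \<in> carrier F \<Longrightarrow> \<beta> (\<alpha> x) = x" using Iso_inv[OF \<alpha>(1)] by blast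
    have "\<beta> y = restrict (inv_into Z \<gamma>) Z y" if y: "y \<in> Z" for y
    proof -
      obtain x where x: "x \<in> Z" "y = \<gamma> x" using IsoD(2)[OF \<gamma>] y by blast
      have "\<beta> y = x" using \<beta>(2)[of x] \<alpha>(2) x Zsub by auto
      then show ?thesis using x y Hom_inj[OF IsoD(1)[OF \<gamma>]] by simp
    qed
    then have "extends_to_carrier Z (restrict (inv_into Z \<gamma>) Z)" unfolding extends_to_carrier_def using \<beta>(1) by blast
    then show ?thesis using inv_Aut_F[OF Z \<gamma>] IsoD(3)[OF \<gamma>] by simp
  qed
  show "\<gamma> \<otimes>\<^bsub>Aut_F F Z\<^esub> \<delta> \<in> ?H" if "\<gamma> \<in> ?H" "\<delta> \<in> ?H" for \<gamma> \<delta>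
  proof -
    from that have i: "\<gamma> \<in> Iso F Z Z" "\<delta> \<in> Iso F Z Z" by auto
    from that obtain \<alpha> \<beta> where \<alpha>: "\<alpha> \<in> Iso F (carrier F) (carrier F)" "\<forall>x\<in>Z. \<alpha> x = \<gamma> x"
      and \<beta>: "\<beta> \<in> Iso F (carrier F) (carrier F)" "\<forall>x\<in>Z. \<beta> x = \<delta> x" by (auto simp: extends_to_carrier_def)
    have "compose (carrier F) \<alpha> \<beta> x = compose Z \<gamma> \<delta> x" if x: "x \<in> Z" for x
      using x Zsub \<alpha>(2) \<beta>(2) Iso_maps[OF i(2) x] by (auto simp: compose_def)
    then have "extends_to_carrier Z (compose Z \<gamma> \<delta>)"
      unfolding extends_to_carrier_def using Iso_compose[OF \<beta>(1) \<alpha>(1)] by blast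
    then show ?thesis using i Iso_compose[OF i(2,1)] by (simp add: mult_Aut_F)
  qed
qed

lemma conj_map_extends_to_carrier:
  assumes "subgroup Z F" "g \<in> carrier F"
  shows "extends_to_carrier Z (conj_map F Z g)"
proof -
  have "g \<in> normalizer F (carrier F)" using assms(2) by (simp add: mem_normalizer[OF subgroup_self])
  then show ?thesis unfolding extends_to_carrier_def
    using conj_map_Iso[OF subgroup_self, of g] subgroup.mem_carrier[OF assms(1)]
    by (intro bexI[of _ "conj_map F (carrier F) g"]) (simp_all add: conj_map_def)
qed

text \<open>
  For an automorphism the condition in the definition of the extender is one about conjugation
  in the group \<open>Aut\<^sub>F(Z)\<close>.
\<close>
lemma mem_extender_Aut:
  assumes Z: "subgroup Z F" and \<delta>: "\<delta> \<in> Iso F Z Z" and g: "g \<in> normalizer F Z"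
    and T: "\<delta> \<otimes>\<^bsub>Aut_F F Z\<^esub> conj_map F Z g \<otimes>\<^bsub>Aut_F F Z\<^esub> inv\<^bsub>Aut_F F Z\<^esub> \<delta> \<in> Aut_S F Z"
  shows "g \<in> extender F Z Z \<delta>"
proof -
  let ?c = "conj_map F Z g"
  have c: "?c \<in> Iso F Z Z" by (rule conj_map_Iso[OF Z g])
  have "\<delta> \<otimes>\<^bsub>Aut_F F Z\<^esub> ?c \<otimes>\<^bsub>Aut_F F Z\<^esub> inv\<^bsub>Aut_F F Z\<^esub> \<delta> =
      compose Z (compose Z \<delta> ?c) (restrict (inv_into Z \<delta>) Z)"
    using inv_Aut_F[OF Z \<delta>] IsoD(3)[OF \<delta>] c \<delta> Iso_compose[OF c \<delta>] by (simp add: mult_Aut_F)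
  also have "\<dots> = (\<lambda>y\<in>Z. \<delta> (?c (inv_into Z \<delta> y)))"
  proof (rule extensionalityI[of _ Z])
    fix y assume y: "y \<in> Z"
    have "inv_into Z \<delta> y \<in> Z" using y IsoD(2)[OF \<delta>] by (metis inv_into_into)
    then show "compose Z (compose Z \<delta> ?c) (restrict (inv_into Z \<delta>) Z) y = (\<lambda>y\<in>Z. \<delta> (?c (inv_into Z \<delta> y))) y"
      using y by (simp add: compose_def)
  qed simp_all
  finally show ?thesis using T g by (simp add: extender_def)
qed

lemma one_mem_Aut_S:
  assumes "subgroup Z F"
  shows "\<one>\<^bsub>Aut_F F Z\<^esub> \<in> Aut_S F Z"
proof -
  have "\<one> \<in> normalizer F Z" by (rule subgroup.one_closed[OF subgroup_normalizer[OF assms]])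
  moreover have "conj_map F Z \<one> = (\<lambda>x\<in>Z. x)"
    using subgroup.mem_carrier[OF assms] by (auto simp: conj_map_def)
  ultimately show ?thesis unfolding Aut_S_def one_Aut_F by (metis imageI)
qed

text \<open>
  The extender of \<open>\<delta>\<close> contains \<open>Z\<close>, because \<open>\<delta> c\<^sub>z \<delta>\<inverse> = c\<^bsub>\<delta>(z)\<^esub>\<close>. A single further element \<open>g\<close>
  makes it strictly larger, and the hypothesis on overgroups takes over.
\<close>
lemma receptive_automorphism_extends:
  assumes Z: "subgroup Z F" "receptive F Z" and \<delta>: "\<delta> \<in> Iso F Z Z"
    and IH: "\<And>Y \<phi> V. \<lbrakk>Z \<subset> Y; \<phi> \<in> Hom F Y V\<rbrakk> \<Longrightarrow> extends_to_carrier Y \<phi>"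
    and g: "g \<in> normalizer F Z" "g \<notin> Z"
      "\<delta> \<otimes>\<^bsub>Aut_F F Z\<^esub> conj_map F Z g \<otimes>\<^bsub>Aut_F F Z\<^esub> inv\<^bsub>Aut_F F Z\<^esub> \<delta> \<in> Aut_S F Z"
  shows "extends_to_carrier Z \<delta>"
proof -
  obtain \<psi> where \<psi>: "\<psi> \<in> Hom F (extender F Z Z \<delta>) (carrier F)" "restrict \<psi> Z = \<delta>"
    using Z(2) \<delta> unfolding receptive_def by metis
  have "z \<in> extender F Z Z \<delta>" if z: "z \<in> Z" for z
  proof (rule mem_extender_Aut[OF Z(1) \<delta>])
    have zN: "z \<in> normalizer F Z" using z subset_normalizer[OF Z(1)] by blast
    then show "z \<in> normalizer F Z" .
    show "\<delta> \<otimes>\<^bsub>Aut_F F Z\<^esub> conj_map F Z z \<otimes>\<^bsub>Aut_F F Z\<^esub> inv\<^bsub>Aut_F F Z\<^esub> \<delta> \<in> Aut_S F Z"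
      using conj_map_transport[OF Z(1) \<delta> IsoD(1)[OF \<delta>] subset_refl refl z zN] by (simp add: Aut_S_def)
  qed
  moreover have "g \<in> extender F Z Z \<delta>" by (rule mem_extender_Aut[OF Z(1) \<delta> g(1,3)])
  ultimately have sub: "Z \<subset> extender F Z Z \<delta>" using g(2) by blast
  obtain \<alpha> where \<alpha>: "\<alpha> \<in> Iso F (carrier F) (carrier F)" "\<forall>x\<in>extender F Z Z \<delta>. \<alpha> x = \<psi> x"
    using IH[OF sub \<psi>(1)] by (auto simp: extends_to_carrier_def)
  have "\<alpha> x = \<delta> x" if x: "x \<in> Z" for x
  proof -
    have "\<alpha> x = \<psi> x" using \<alpha>(2) sub x by blast
    also have "\<dots> = \<delta> x" using \<psi>(2) x by (metis restrict_apply')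
    finally show ?thesis .
  qed
  then show ?thesis using \<alpha>(1) unfolding extends_to_carrier_def by blast
qed

text \<open>
  If \<open>C\<^sub>S(Z)\<close> is not contained in \<open>Z\<close>, it lies in every extender, and
  \<open>receptive_automorphism_extends\<close> applies. Otherwise \<open>Z\<close> is centric and fully normalised, so it
  fails to be essential only for lack of a strongly embedded subgroup in \<open>Out\<^sub>F(Z)\<close>. The group \<open>H\<close> of
  those automorphisms that do extend contains \<open>Aut\<^sub>S(Z) > Inn(Z)\<close>; were it proper, \<open>H/Inn(Z)\<close> would
  be strongly embedded. Indeed, if \<open>g\<close> conjugates into \<open>H\<close> a \<open>p\<close>-subgroup \<open>Q\<close> of \<open>H\<close> with
  \<open>Inn(Z) < Q\<close>, then by Sylow's theorem in \<open>H\<close> some element of \<open>HgH\<close> carries an element of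
  \<open>Aut\<^sub>S(Z)\<close> outside \<open>Inn(Z)\<close> into \<open>Aut\<^sub>S(Z)\<close>, and therefore extends.
\<close>
lemma non_essential_automorphism_extends:
  assumes Z: "subgroup Z F" "fully_automised p F Z" "receptive F Z" "Z \<noteq> carrier F" "Z \<notin> essentials p F"
    and IH: "\<And>Y \<phi> V. \<lbrakk>Z \<subset> Y; \<phi> \<in> Hom F Y V\<rbrakk> \<Longrightarrow> extends_to_carrier Y \<phi>"
    and \<gamma>: "\<gamma> \<in> Iso F Z Z"
  shows "extends_to_carrier Z \<gamma>"
proof (cases "centralizer F Z \<subseteq> Z")
  case False
  then obtain c where c: "c \<in> centralizer F Z" "c \<notin> Z" by blast
  interpret A: group "Aut_F F Z" by (rule group_Aut_F[OF Z(1)])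
  have cc: "c \<in> carrier F" using c(1) by (simp add: centralizer_def)
  have cx: "c \<otimes> x \<otimes> inv c = x" if "x \<in> Z" for x
    using that c(1) cc subgroup.mem_carrier[OF Z(1) that] by (simp add: centralizer_def m_assoc)
  have cN: "c \<in> normalizer F Z" using cc cx by (simp add: mem_normalizer[OF Z(1)])
  have one: "conj_map F Z c = \<one>\<^bsub>Aut_F F Z\<^esub>" using cx by (auto simp: conj_map_def one_Aut_F)
  have \<gamma>A: "\<gamma> \<in> carrier (Aut_F F Z)" using \<gamma> by (simp add: carrier_Aut_F)
  show ?thesis
    by (rule receptive_automorphism_extends[OF Z(1,3) \<gamma> IH cN c(2)])
      (use one one_mem_Aut_S[OF Z(1)] A.r_one[OF \<gamma>A] A.r_inv[OF \<gamma>A] in simp_all)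
next
  case True
  interpret A: group "Aut_F F Z" by (rule group_Aut_F[OF Z(1)])
  note finA = finite_Aut_F[OF Z(1)]
  have no_emb: "\<not> strongly_embedded p (Aut_F F Z Mod Inn F Z) H" for H
    using Z(5) Z(1) fully_automised_receptive_imp_fully_normalised[OF Z(2,3)] fully_automised_receptive_imp_centric[OF Z(2,3) True]
    by (auto simp: essentials_def Out_F_def)
  define H where "H = {\<gamma> \<in> Iso F Z Z. extends_to_carrier Z \<gamma>}"
  have H: "subgroup H (Aut_F F Z)" unfolding H_def by (rule subgroup_extending_automorphisms[OF Z(1)])
  let ?T = "Aut_S F Z"
  have T: "sylow_subgroup p (Aut_F F Z) ?T" using Z(2) by (simp add: fully_automised_def)
  have TH: "?T \<subseteq> H"
    using conj_map_Iso[OF Z(1)] conj_map_extends_to_carrier[OF Z(1)] mem_normalizer[OF Z(1)] by (auto simp: Aut_S_def H_def)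
  have Tp: "p_subgroup p (Aut_F F Z) ?T" unfolding Aut_S_def
    by (rule p_subgroup_conj_maps[OF Z(1) subgroup_normalizer[OF Z(1)] subset_refl])
  have Ip: "p_subgroup p (Aut_F F Z) (Inn F Z)" unfolding Inn_def
    by (rule p_subgroup_conj_maps[OF Z(1) Z(1) subset_normalizer[OF Z(1)]])
  have I: "Inn F Z \<lhd> Aut_F F Z" by (rule Inn_normal[OF Z(1)])
  have IT: "Inn F Z \<subset> ?T"
  proof
    show "Inn F Z \<subseteq> ?T" unfolding Inn_def Aut_S_def using subset_normalizer[OF Z(1)] by (rule image_mono)
    obtain g where g: "g \<in> normalizer F Z" "g \<notin> Z"
      using proper_subgroup_psubset_normalizer[OF Z(1,4)] by blast
    then have gc: "g \<in> carrier F" by (simp add: mem_normalizer[OF Z(1)])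
    have "conj_map F Z g \<notin> Inn F Z"
      using conj_map_eq_imp[OF Z(1) gc _ _ True] g(2) by (auto simp: Inn_def)
    then show "Inn F Z \<noteq> ?T" using g(1) by (auto simp: Aut_S_def)
  qed
  have emb: "g \<in> H" if g: "g \<in> carrier (Aut_F F Z)" and Q: "p_subgroup p (Aut_F F Z) Q" "Inn F Z \<subset> Q" "Q \<subseteq> H"
    and cj: "\<And>x. x \<in> Q \<Longrightarrow> inv\<^bsub>Aut_F F Z\<^esub> g \<otimes>\<^bsub>Aut_F F Z\<^esub> x \<otimes>\<^bsub>Aut_F F Z\<^esub> g \<in> H" for g Q
  proof -
    let ?m = "monoid.mult (Aut_F F Z)" and ?i = "m_inv (Aut_F F Z)"
    let ?B = "(Aut_F F Z)\<lparr>carrier := H\<rparr>"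
    interpret B: group ?B by (rule A.subgroup_imp_group[OF H])
    have finB: "finite (carrier ?B)" using finA subgroup.subset[OF H] by (simp add: finite_subset)
    have TB: "sylow_subgroup p ?B ?T" by (rule A.sylow_subgroup_in_subgroup[OF finA prime_p T H TH])
    have QB: "p_subgroup p ?B Q" using Q A.subgroup_incl[OF _ H Q(3)] by (simp add: p_subgroup_def)
    let ?Q' = "(\<lambda>x. ?m (?m (?i g) x) g) ` Q"
    have "p_subgroup p (Aut_F F Z) ?Q'" by (rule A.p_subgroup_conjugate[OF prime_p g Q(1)])
    moreover have Q'H: "?Q' \<subseteq> H" using cj by blast
    ultimately have Q'B: "p_subgroup p ?B ?Q'" using A.subgroup_incl[OF _ H Q'H] by (simp add: p_subgroup_def)
    obtain h where hB: "h \<in> carrier ?B" "\<forall>x\<in>Q. h \<otimes>\<^bsub>?B\<^esub> x \<otimes>\<^bsub>?B\<^esub> inv\<^bsub>?B\<^esub> h \<in> ?T"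
      using B.p_subgroup_conj_into_sylow[OF finB prime_p TB QB] by blast
    obtain k where kB: "k \<in> carrier ?B" "\<forall>x\<in>?Q'. k \<otimes>\<^bsub>?B\<^esub> x \<otimes>\<^bsub>?B\<^esub> inv\<^bsub>?B\<^esub> k \<in> ?T"
      using B.p_subgroup_conj_into_sylow[OF finB prime_p TB Q'B] by blast
    have h: "h \<in> H" "\<And>x. x \<in> Q \<Longrightarrow> ?m (?m h x) (?i h) \<in> ?T"
      using hB A.m_inv_consistent[OF H] by auto
    have k: "k \<in> H" "\<And>x. x \<in> ?Q' \<Longrightarrow> ?m (?m k x) (?i k) \<in> ?T"
      using kB A.m_inv_consistent[OF H] by auto
    have hA: "h \<in> carrier (Aut_F F Z)" and kA: "k \<in> carrier (Aut_F F Z)"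
      using h(1) k(1) subgroup.mem_carrier[OF H] by auto
    \<comment> \<open>The representative of \<open>HgH\<close> chosen so that it carries \<open>k g\<inverse> x g k\<inverse>\<close> to \<open>h x h\<inverse>\<close> for \<open>x \<in> Q\<close>.\<close>
    define \<delta> where "\<delta> = ?m (?m h g) (?i k)"
    have \<delta>A: "\<delta> \<in> carrier (Aut_F F Z)" using hA kA g by (simp add: \<delta>_def)
    obtain x where x: "x \<in> Q" "x \<notin> Inn F Z" using Q(2) by blast
    have xA: "x \<in> carrier (Aut_F F Z)" using x(1) Q(1) by (meson p_subgroup_def subgroup.mem_carrier)
    define t where "t = ?m (?m k (?m (?m (?i g) x) g)) (?i k)"
    have tT: "t \<in> ?T" using k(2) x(1) by (auto simp: t_def)
    then obtain n where n: "n \<in> normalizer F Z" "t = conj_map F Z n" by (auto simp: Aut_S_def)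
    have tA: "t \<in> carrier (Aut_F F Z)" using kA g xA by (simp add: t_def)
    have cancel: "?m (?i a) (?m a b) = b" if "a \<in> carrier (Aut_F F Z)" "b \<in> carrier (Aut_F F Z)" for a b
      using that by (simp add: A.m_assoc[symmetric])
    have cancel': "?m a (?m (?i a) b) = b" if "a \<in> carrier (Aut_F F Z)" "b \<in> carrier (Aut_F F Z)" for a b
      using that by (simp add: A.m_assoc[symmetric])
    have \<delta>t: "?m (?m \<delta> t) (?i \<delta>) = ?m (?m h x) (?i h)"
      using hA kA g xA by (simp add: \<delta>_def t_def A.m_assoc A.inv_mult_group cancel cancel')
    have nZ: "n \<notin> Z"
    proof
      assume "n \<in> Z"
      then have "t \<in> Inn F Z" using n(2) by (simp add: Inn_def)
      let ?u = "?m g (?i k)"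
      have u: "?u \<in> carrier (Aut_F F Z)" using g kA by simp
      have "?m (?m ?u t) (?i ?u) = x"
        using kA g xA by (simp add: t_def A.m_assoc A.inv_mult_group cancel cancel')
      then have "x \<in> Inn F Z" using normal.inv_op_closed2[OF I u \<open>t \<in> Inn F Z\<close>] by simp
      then show False using x(2) by simp
    qed
    have \<delta>I: "\<delta> \<in> Iso F Z Z" using \<delta>A by (simp add: carrier_Aut_F)
    have "extends_to_carrier Z \<delta>"
      by (rule receptive_automorphism_extends[OF Z(1,3) \<delta>I IH n(1) nZ])
        (use \<delta>t h(2)[OF x(1)] n(2) in simp_all)
    then have \<delta>H: "\<delta> \<in> H" using \<delta>I by (simp add: H_def)
    have "g = ?m (?m (?i h) \<delta>) k" using hA kA g by (simp add: \<delta>_def A.m_assoc cancel)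
    moreover have "?m (?m (?i h) \<delta>) k \<in> H" using \<delta>H h(1) k(1) H by (simp add: subgroup.m_closed subgroup.m_inv_closed)
    ultimately show ?thesis by simp
  qed
  have "H = carrier (Aut_F F Z)"
  proof (rule ccontr)
    assume Hne: "H \<noteq> carrier (Aut_F F Z)"
    have IH': "Inn F Z \<subseteq> H" using IT TH by blast
    have "strongly_embedded p (Aut_F F Z Mod Inn F Z) ((\<lambda>x. Inn F Z #>\<^bsub>Aut_F F Z\<^esub> x) ` H)"
    proof (rule A.strongly_embedded_ModI[OF finA prime_p I Ip H IH' Hne Tp IT TH])
      fix g Q
      assume "g \<in> carrier (Aut_F F Z)" "p_subgroup p (Aut_F F Z) Q" "Inn F Z \<subset> Q" "Q \<subseteq> H"
        "\<And>x. x \<in> Q \<Longrightarrow> inv\<^bsub>Aut_F F Z\<^esub> g \<otimes>\<^bsub>Aut_F F Z\<^esub> x \<otimes>\<^bsub>Aut_F F Z\<^esub> g \<in> H"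
      then show "g \<in> H" by (rule emb)
    qed
    then show False using no_emb by blast
  qed
  then show ?thesis using \<gamma> by (auto simp: H_def carrier_Aut_F)
qed

end

context saturated_fusion_system
begin

text \<open>
  A form of Alperin's fusion theorem: without essential subgroups in \<open>C\<close>, fusion in \<open>C\<close> is
  controlled by \<open>Aut\<^sub>F(S)\<close>. Induction is on the index. With a fully automised, receptive conjugate \<open>Z\<close>
  of \<open>X\<close>, suitable isomorphisms \<open>\<alpha>\<chi> : X \<rightarrow> Z\<close> and \<open>\<beta>\<chi>\<phi>\<inverse> : \<phi>(X) \<rightarrow> Z\<close> extend to the larger subgroups
  \<open>N\<^sub>S(X)\<close> and \<open>N\<^sub>S(\<phi>(X))\<close>, hence to \<open>S\<close>. They differ from \<open>\<phi>\<close> only by the automorphism \<open>\<beta>\<alpha>\<inverse>\<close> of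
  \<open>Z\<close>, which extends because \<open>Z\<close> is not essential.
\<close>
lemma extends_to_carrier_of_no_essentials:
  assumes sub: "\<And>X. X \<in> C \<Longrightarrow> subgroup X F"
    and conj: "\<And>X Y \<phi>. \<lbrakk>X \<in> C; \<phi> \<in> Iso F X Y\<rbrakk> \<Longrightarrow> Y \<in> C"
    and up: "\<And>X Y. \<lbrakk>X \<in> C; X \<subset> Y; subgroup Y F\<rbrakk> \<Longrightarrow> Y \<in> C"
    and ess: "C \<inter> essentials p F = {}"
    and X: "X \<in> C" "\<phi> \<in> Hom F X V"
  shows "extends_to_carrier X \<phi>"
  using X
proof (induction "card (carrier F) - card X" arbitrary: X \<phi> V rule: less_induct)
  case less
  note XC = less.prems(1) and \<phi> = less.prems(2)
  note Xs = sub[OF XC]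
  have IH: "extends_to_carrier Y \<psi>" if "Y \<in> C" "card X < card Y" "\<psi> \<in> Hom F Y W" for Y \<psi> W
  proof (rule less.hyps[OF _ that(1,3)])
    have "card Y \<le> card (carrier F)" by (rule card_mono[OF finite_carrier subgroup.subset[OF sub[OF that(1)]]])
    then show "card (carrier F) - card Y < card (carrier F) - card X" using that(2) by simp
  qed
  show ?case
  proof (cases "X = carrier F")
    case True
    have h: "\<phi> \<in> Hom F (carrier F) (carrier F)" using Hom_carrier[OF \<phi>] True by simp
    then have "\<phi> ` carrier F = carrier F"
      using endo_inj_surj[OF finite_carrier Hom_image[OF h] Hom_inj[OF h]] by blast
    then have "\<phi> \<in> Iso F (carrier F) (carrier F)" using h by (simp add: Iso_altdef)
    then show ?thesis unfolding extends_to_carrier_def by blast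
  next
    case False
    obtain Z where Z: "F_conjugate F X Z" "fully_automised p F Z" "receptive F Z" using saturated[OF Xs] by blast
    obtain \<chi> where \<chi>: "\<chi> \<in> Iso F X Z" using Z(1) by (auto simp: F_conjugate_def)
    have ZC: "Z \<in> C" by (rule conj[OF XC \<chi>])
    note Zs = sub[OF ZC]
    have cZ: "card X = card Z" by (rule Iso_card[OF \<chi>])
    have cX: "card X < card (carrier F)"
      using False subgroup.subset[OF Xs] finite_carrier by (simp add: psubset_card_mono psubsetI)
    have to_Z: "\<exists>\<alpha> \<in> Iso F Z Z. \<exists>A \<in> Iso F (carrier F) (carrier F). \<forall>x\<in>R. A x = \<alpha> (\<kappa> x)"
      if R: "R \<in> C" "\<kappa> \<in> Iso F R Z" for R \<kappa>
    proof -
      have cR: "card R = card X" using Iso_card[OF R(2)] cZ by simp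
      then have "R \<noteq> carrier F" using cX by auto
      then have RN: "R \<subset> normalizer F R" by (rule proper_subgroup_psubset_normalizer[OF sub[OF R(1)]])
      have Ns: "subgroup (normalizer F R) F" by (rule subgroup_normalizer[OF sub[OF R(1)]])
      have NC: "normalizer F R \<in> C" by (rule up[OF R(1) RN Ns])
      have cN: "card X < card (normalizer F R)" using psubset_card_mono[OF finite_subgroup[OF Ns] RN] cR by simp
      obtain \<alpha> \<psi> where \<alpha>: "\<alpha> \<in> Iso F Z Z" and \<psi>: "\<psi> \<in> Hom F (normalizer F R) (carrier F)" "\<forall>x\<in>R. \<psi> x = \<alpha> (\<kappa> x)"
        using fully_automised_receptive_extend_to_normalizer[OF Z(2,3) R(2)] by blast
      obtain A where A: "A \<in> Iso F (carrier F) (carrier F)" "\<forall>x\<in>normalizer F R. A x = \<psi> x"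
        using IH[OF NC cN \<psi>(1)] by (auto simp: extends_to_carrier_def)
      have "A x = \<alpha> (\<kappa> x)" if "x \<in> R" for x using A(2) \<psi>(2) that RN by auto
      then show ?thesis using \<alpha> A(1) by blast
    qed
    have aut: "extends_to_carrier Z \<gamma>" if \<gamma>: "\<gamma> \<in> Iso F Z Z" for \<gamma>
    proof (rule non_essential_automorphism_extends[OF Zs Z(2,3) _ _ _ \<gamma>])
      show "Z \<noteq> carrier F" using cX cZ by auto
      show "Z \<notin> essentials p F" using ess ZC by blast
      fix Y \<psi> W assume Y: "Z \<subset> Y" "\<psi> \<in> Hom F Y W"
      have Ys: "subgroup Y F" using Hom_subgroups[OF Y(2)] by simp
      show "extends_to_carrier Y \<psi>"
        by (rule IH[OF up[OF ZC Y(1) Ys] _ Y(2)]) (use psubset_card_mono[OF finite_subgroup[OF Ys] Y(1)] cZ in simp)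
    qed
    define Y where "Y = \<phi> ` X"
    have \<phi>i: "\<phi> \<in> Iso F X Y" unfolding Y_def by (rule Hom_factor[OF \<phi>])
    have YC: "Y \<in> C" by (rule conj[OF XC \<phi>i])
    obtain \<phi>' where \<phi>': "\<phi>' \<in> Iso F Y X" "\<And>x. x \<in> X \<Longrightarrow> \<phi>' (\<phi> x) = x" using Iso_inv[OF \<phi>i] by blast
    obtain \<alpha> A where \<alpha>: "\<alpha> \<in> Iso F Z Z" and A: "A \<in> Iso F (carrier F) (carrier F)" "\<forall>x\<in>X. A x = \<alpha> (\<chi> x)"
      using to_Z[OF XC \<chi>] by blast
    obtain \<beta> B where \<beta>: "\<beta> \<in> Iso F Z Z" and B: "B \<in> Iso F (carrier F) (carrier F)" "\<forall>y\<in>Y. B y = \<beta> (compose Y \<chi> \<phi>' y)"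
      using to_Z[OF YC Iso_compose[OF \<phi>'(1) \<chi>]] by blast
    obtain \<alpha>' where \<alpha>': "\<alpha>' \<in> Iso F Z Z" "\<And>z. z \<in> Z \<Longrightarrow> \<alpha>' (\<alpha> z) = z"
      by (rule Iso_inv[OF \<alpha>], rule that) simp_all
    obtain B' where B': "B' \<in> Iso F (carrier F) (carrier F)" "\<And>z. z \<in> carrier F \<Longrightarrow> B' (B z) = z"
      by (rule Iso_inv[OF B(1)], rule that) simp_all
    obtain \<Gamma> where \<Gamma>: "\<Gamma> \<in> Iso F (carrier F) (carrier F)" "\<forall>z\<in>Z. \<Gamma> z = compose Z \<beta> \<alpha>' z"
      using aut[OF Iso_compose[OF \<alpha>'(1) \<beta>]] by (auto simp: extends_to_carrier_def)
    \<comment> \<open>\<open>\<phi> = (\<beta>\<chi>\<phi>\<inverse>)\<inverse> (\<beta>\<alpha>\<inverse>) (\<alpha>\<chi>)\<close>, with each factor replaced by its extension to \<open>S\<close>.\<close>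
    let ?E = "compose (carrier F) B' (compose (carrier F) \<Gamma> A)"
    have E: "?E \<in> Iso F (carrier F) (carrier F)" by (rule Iso_compose[OF Iso_compose[OF A(1) \<Gamma>(1)] B'(1)])
    have "?E x = \<phi> x" if x: "x \<in> X" for x
    proof -
      have xc: "x \<in> carrier F" using x Xs by (simp add: subgroup.mem_carrier)
      have \<chi>x: "\<chi> x \<in> Z" by (rule Iso_maps[OF \<chi> x])
      have \<phi>x: "\<phi> x \<in> Y" "\<phi> x \<in> carrier F" using x sub[OF YC] by (auto simp: Y_def subgroup.mem_carrier)
      have "\<Gamma> (A x) = \<beta> (\<chi> x)" using A(2) x \<Gamma>(2) Iso_maps[OF \<alpha> \<chi>x] \<alpha>'(2)[OF \<chi>x] by (simp add: compose_def)
      also have "\<dots> = B (\<phi> x)" using B(2) \<phi>x(1) \<phi>'(2)[OF x] by (simp add: compose_def)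
      finally show ?thesis using xc B'(2)[OF \<phi>x(2)] by (simp add: compose_def)
    qed
    then show ?thesis using E unfolding extends_to_carrier_def by blast
  qed
qed

text \<open>
  The subgroups strictly above \<open>O\<^sub>p(F)\<close> are closed under \<open>F\<close>-conjugation and none of them is
  essential, so morphisms between them are restrictions of automorphisms of \<open>S\<close> in \<open>F\<close>. A morphism of
  \<open>N\<^sub>F(Q)\<close>, extended to contain \<open>Q\<close> in its domain, thus extends to an automorphism of \<open>S\<close> that stabilises
  \<open>Q\<close> and with it \<open>N\<^sub>S(Q)\<close>. So \<open>N\<^sub>S(Q)\<close> is normal in \<open>N\<^sub>F(Q)\<close>, and \<open>N\<^sub>S(Q) \<le> O\<^sub>p(N\<^sub>F(Q)) = Q\<close>.
\<close>
lemma centric_radical_eq_carrier_of_no_essentials: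
  assumes ess: "essentials p F \<subseteq> {O_p F}" and Q: "Q \<in> centric_radicals F" "Q \<noteq> O_p F"
  shows "Q = carrier F"
proof (rule ccontr)
  assume Qne: "Q \<noteq> carrier F"
  have Qs: "subgroup Q F" and QO: "O_p (normalizer_fs F Q) = Q" using Q(1) by (auto simp: centric_radicals_def)
  have OQ: "O_p F \<subset> Q" using centric_radical_contains_O_p[OF Q(1)] Q(2) by blast
  let ?C = "{X. subgroup X F \<and> O_p F \<subset> X}"
  have ext: "extends_to_carrier X \<phi>" if X: "X \<in> ?C" "\<phi> \<in> Hom F X V" for X \<phi> V
  proof (rule extends_to_carrier_of_no_essentials[OF _ _ _ _ X])
    fix X Y \<phi> assume X: "X \<in> ?C" and \<phi>: "\<phi> \<in> Iso F X Y"
    have OX: "O_p F \<subset> X" using X by simp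
    have "\<phi> ` O_p F = O_p F"
      by (rule normal_fs_image[OF normal_fs_O_p IsoD(1)[OF \<phi>] psubset_imp_subset[OF OX]])
    moreover have "\<phi> ` O_p F \<subset> \<phi> ` X" by (rule image_strict_mono[OF Hom_inj[OF IsoD(1)[OF \<phi>]] OX])
    ultimately show "Y \<in> ?C" using IsoD(2)[OF \<phi>] Hom_subgroups[OF IsoD(1)[OF \<phi>]] by simp
  qed (use ess in auto)
  let ?N = "normalizer_fs F Q" and ?R = "normalizer F Q"
  interpret N: fusion_system ?N p by (rule fusion_system_normalizer_fs[OF Qs])
  have Rs: "subgroup ?R F" by (rule subgroup_normalizer[OF Qs])
  have QR: "Q \<subset> ?R" by (rule proper_subgroup_psubset_normalizer[OF Qs Qne])
  have "normal_fs ?N ?R"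
  proof (rule N.normal_fsI)
    show "subgroup ?R ?N" using Rs by (simp add: subgroup_normalizer_fs[OF Qs])
    fix U V \<phi> assume \<phi>: "\<phi> \<in> Hom ?N U V"
    note d = Hom_normalizer_fsD[OF \<phi>]
    from d(4) obtain \<psi> where \<psi>: "\<psi> \<in> Hom F (U <#> Q) (V <#> Q)" "\<forall>x\<in>U. \<psi> x = \<phi> x" "\<psi> ` Q = Q" by blast
    have U: "subgroup U F" using Hom_subgroups[OF d(1)] by simp
    note s = subset_mult[OF U Qs]
    have "U <#> Q \<in> ?C" using Hom_subgroups[OF \<psi>(1)] OQ s(2) by blast
    from ext[OF this \<psi>(1)] obtain \<alpha> where \<alpha>: "\<alpha> \<in> Iso F (carrier F) (carrier F)" "\<forall>x\<in>U <#> Q. \<alpha> x = \<psi> x"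
      by (auto simp: extends_to_carrier_def)
    have "\<alpha> ` Q = \<psi> ` Q" using \<alpha>(2) s(2) by (intro image_cong refl) (simp add: subsetD)
    then have \<alpha>Q: "\<alpha> ` Q = Q" using \<psi>(3) by simp
    note \<alpha>h = IsoD(1)[OF \<alpha>(1)]
    have Rc: "?R \<subseteq> carrier F" by (rule subgroup.subset[OF Rs])
    have Qc: "Q \<subseteq> carrier F" by (rule subgroup.subset[OF Qs])
    have \<alpha>R: "\<alpha> ` ?R \<subseteq> ?R" using Hom_normalizer[OF \<alpha>h Qs Qc] \<alpha>Q Rc by auto
    have im: "\<alpha> ` ?R = ?R"
      by (rule endo_inj_surj[OF finite_subgroup[OF Rs] \<alpha>R inj_on_subset[OF Hom_inj[OF \<alpha>h] Rc]])
    have 1: "restrict \<alpha> ?R \<in> Hom ?N ?R ?R"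
      by (rule restrict_in_Hom_normalizer_fs[OF \<alpha>h Rs Rc subset_refl Qs Qc \<alpha>Q Rs \<alpha>R subset_refl])
    have 2: "\<forall>x\<in>U. restrict \<alpha> ?R x = \<phi> x" using \<alpha>(2) \<psi>(2) s(1) d(2) by (auto simp: subset_iff)
    have 3: "restrict \<alpha> ?R ` ?R = ?R" using im by simp
    show "\<exists>W X \<psi>. \<psi> \<in> Hom ?N W X \<and> U \<subseteq> W \<and> ?R \<subseteq> W \<and> (\<forall>x\<in>U. \<psi> x = \<phi> x) \<and> \<psi> ` ?R = ?R"
      using 1 2 3 d(2) by blast
  qed
  from N.normal_fs_subset_O_p[OF this] show False using QO QR by simp
qed

lemma essentials_iff_centric_radicals:
  "essentials p F - {O_p F} \<noteq> {} \<longleftrightarrow> centric_radicals F - {carrier F, O_p F} \<noteq> {}"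
proof
  assume "essentials p F - {O_p F} \<noteq> {}"
  then obtain E where E: "E \<in> essentials p F" "E \<noteq> O_p F" by blast
  have "E \<noteq> carrier F" using E(1) carrier_not_essential by blast
  then show "centric_radicals F - {carrier F, O_p F} \<noteq> {}"
    using essential_centric_radical[OF E(1)] E(2) by blast
next
  assume "centric_radicals F - {carrier F, O_p F} \<noteq> {}"
  then obtain Q where Q: "Q \<in> centric_radicals F" "Q \<noteq> O_p F" "Q \<noteq> carrier F" by blast
  then show "essentials p F - {O_p F} \<noteq> {}"
    using centric_radical_eq_carrier_of_no_essentials[OF _ Q(1,2)] by blast
qed

end

section \<open>Fusion systems of weakly local rank two\<close>

theorem proposition5p2:
  fixes F :: "'a fusion" and p :: nat
  assumes "saturated_fusion_system F p"
  shows "rank_w F = 2 \<longleftrightarrow>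
    essentials p F - {O_p F} \<noteq> {} \<and>
    (\<forall>Q \<in> centric_radicals F - {carrier F, O_p F}.
       centric_radicals (normalizer_fs F Q) - {Q, normalizer F Q} = {})"
proof -
  interpret saturated_fusion_system F p by (rule assms)
  show ?thesis unfolding rank_w_eq_2_iff essentials_iff_centric_radicals ..
qed

end
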